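(* Let $G$ be a bipartite graph with vertex set $V(G)=\{x_1,\dots,x_n\}$, let $\mathbb{K}$ be a field, let $S=\mathbb{K}[x_1,\dots,x_n]$, and let $J(G)\subseteq S$ be the cover ideal of $G$. Let $\nu_o(G)$ be the ordered matching number of $G$. Then for every integer $k\geq 1$, $$\mathrm{sdepth}(J(G)^k)\geq n-\nu_o(G)\quad\text{and}\quad \mathrm{sdepth}(S/J(G)^k)\geq n-\nu_o(G)-1.$$
   Context: Graphs are finite and simple; the vertices of $G$ are identified with the variables of $S$. A graph is bipartite if its vertex set is partitioned into two disjoint (not necessarily nonempty) subsets such that the two endpoints of each edge lie in distinct parts. Cover ideal: $J(G)=\bigcap_{\{x_i,x_j\}\in E(G)}(x_i,x_j)\subseteq S$ (so $J(G)=S$ if $G$ has no edges). $J(G)^k$ denotes the ordinary $k$-th power. Ordered matching: a nonempty matching $M=\{\{a_i,b_i\}\mid 1\leq i\leq r\}$ of $G$ (a set of pairwise disjoint edges, with a chosen labelling of the edges and their endpoints) is an ordered matching if (1) $\{a_1,\dots,a_r\}$ is an independent set of vertices of $G$, and (2) $\{a_i,b_j\}\in E(G)$ implies $i\leq j$. The ordered matching number $\nu_o(G)$ is the maximum of $|M|$ over all ordered matchings $M$ of $G$, with $\nu_o(G)=0$ if $G$ has no edges. Stanley depth: let $M$ be a finitely generated $\mathbb{Z}^n$-graded $S$-module. For a homogeneous element $u\in M$ and $Z\subseteq\{x_1,\dots,x_n\}$, the $\mathbb{K}$-subspace $u\mathbb{K}[Z]$ generated by all $uv$ with $v\in\mathbb{K}[Z]$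 is called a Stanley space of dimension $|Z|$ if it is a free $\mathbb{K}[Z]$-module. A Stanley decomposition $\mathcal{D}$ of $M$ is a decomposition of $M$ as a finite direct sum (of $\mathbb{K}$-vector spaces) of Stanley spaces; $\mathrm{sdepth}(\mathcal{D})$ is the minimum dimension of a Stanley space in $\mathcal{D}$; and $\mathrm{sdepth}(M)$ is the maximum of $\mathrm{sdepth}(\mathcal{D})$ over all Stanley decompositions $\mathcal{D}$ of $M$. The Stanley depth of the zero module is $+\infty$ by convention. *)

theory Defs
  imports
    "HOL-Algebra.Module"
    "HOL-Algebra.QuotRing"
    "HOL-Algebra.Ideal_Product"
    "HOL-Library.Poly_Mapping"
    "HOL-Library.Extended_Nat"
    "HOL-Library.FuncSet"
    "HOL-Library.Disjoint_Sets"
begin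

section \<open>Graphs\<close>

definition simple_graph :: "'v set \<Rightarrow> 'v set set \<Rightarrow> bool" where
  "simple_graph V E \<longleftrightarrow> finite V \<and> (\<forall>e\<in>E. e \<subseteq> V \<and> card e = 2)"

definition bipartite :: "'v set \<Rightarrow> 'v set set \<Rightarrow> bool" where
  "bipartite V E \<longleftrightarrow>
     (\<exists>A B. A \<union> B = V \<and> A \<inter> B = {} \<and>
        (\<forall>u v. {u, v} \<in> E \<longrightarrow> (u \<in> A \<and> v \<in> B) \<or> (u \<in> B \<and> v \<in> A)))"

definition independent_set :: "'v set set \<Rightarrow> 'v set \<Rightarrow> bool" where
  "independent_set E A \<longleftrightarrow> (\<forall>u\<in>A. \<forall>v\<in>A. {u, v} \<notin> E)"

definition ordered_matching :: "'v set set \<Rightarrow> 'v set set \<Rightarrow> bool" where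
  "ordered_matching E M \<longleftrightarrow>
     M \<noteq> {} \<and> M \<subseteq> E \<and> disjoint M \<and>
     (\<exists>(r::nat) a b.
        bij_betw (\<lambda>i. {a i, b i}) {1..r} M \<and>
        independent_set E (a ` {1..r}) \<and>
        (\<forall>i\<in>{1..r}. \<forall>j\<in>{1..r}. {a i, b j} \<in> E \<longrightarrow> i \<le> j))"

definition ordered_matching_number :: "'v set set \<Rightarrow> nat" where
  "ordered_matching_number E =
     (if E = {} then 0 else Max (card ` {M. ordered_matching E M}))"


section \<open>Polynomial rings and cover ideals\<close>

text \<open>
  A monomial is its exponent vector, a polynomial is a finitely supported family of
  coefficients. The type \<open>'v\<close> may contain more elements than the variables in use;
  \<open>poly_ring V\<close> is the polynomial ring in the variables \<open>V\<close>.
\<close>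

type_synonym ('v, 'k) mpoly = "('v \<Rightarrow>\<^sub>0 nat) \<Rightarrow>\<^sub>0 'k"

definition polys_in :: "'v set \<Rightarrow> ('v, 'k::field) mpoly set" where
  "polys_in Z = {p. \<forall>m\<in>Poly_Mapping.keys p. Poly_Mapping.keys m \<subseteq> Z}"

definition poly_ring :: "'v set \<Rightarrow> ('v, 'k::field) mpoly ring" where
  "poly_ring V =
     \<lparr>carrier = polys_in V, monoid.mult = (*), one = 1, ring.zero = 0, add = (+)\<rparr>"

definition var :: "'v \<Rightarrow> ('v, 'k::field) mpoly" where
  "var v = Poly_Mapping.single (Poly_Mapping.single v 1) 1"

text \<open>The intersection with the carrier makes the ideal the whole ring if there is no edge.\<close>

definition cover_ideal :: "'v set \<Rightarrow> 'v set set \<Rightarrow> ('v, 'k::field) mpoly set" where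
  "cover_ideal V E = carrier (poly_ring V) \<inter> (\<Inter>e\<in>E. Idl\<^bsub>poly_ring V\<^esub> (var ` e))"


section \<open>Multigraded modules and Stanley depth\<close>

text \<open>
  A \<open>\<int>\<^sup>n\<close>-graded module over \<open>poly_ring V\<close> is given by a module record \<open>M\<close> and the family
  \<open>gr\<close> of its homogeneous components, indexed by multidegrees \<open>a :: 'v \<Rightarrow> int\<close>.
  The ring multiplication and unit that a module record inherits play no role.

  A pair \<open>(u, Z)\<close> encodes the space \<open>u\<K>[Z]\<close>. Being cyclic, it is free over
  \<open>\<K>[Z]\<close> (and nonzero) iff \<open>u\<close> is a basis, i.e. iff multiplication by \<open>u\<close> is injective
  on \<open>\<K>[Z]\<close>.
\<close>

definition stanley_span ::
    "(('v, 'k::field) mpoly, 'm) module \<Rightarrow> 'm \<times> 'v set \<Rightarrow> 'm set" where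
  "stanley_span M = (\<lambda>(u, Z). {v \<odot>\<^bsub>M\<^esub> u |v. v \<in> polys_in Z})"

definition stanley_space ::
    "'v set \<Rightarrow> (('v, 'k::field) mpoly, 'm) module \<Rightarrow> (('v \<Rightarrow> int) \<Rightarrow> 'm set) \<Rightarrow>
     'm \<times> 'v set \<Rightarrow> bool" where
  "stanley_space V M gr = (\<lambda>(u, Z).
     u \<in> carrier M \<and> (\<exists>a. u \<in> gr a) \<and> Z \<subseteq> V \<and> inj_on (\<lambda>v. v \<odot>\<^bsub>M\<^esub> u) (polys_in Z))"

definition stanley_decomposition ::
    "'v set \<Rightarrow> (('v, 'k::field) mpoly, 'm) module \<Rightarrow> (('v \<Rightarrow> int) \<Rightarrow> 'm set) \<Rightarrow>
     ('m \<times> 'v set) set \<Rightarrow> bool" where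
  "stanley_decomposition V M gr D \<longleftrightarrow>
     finite D \<and> (\<forall>d\<in>D. stanley_space V M gr d) \<and>
     (\<forall>x\<in>carrier M. \<exists>!f. f \<in> Pi\<^sub>E D (stanley_span M) \<and> x = finsum M f D)"

text \<open>
  In \<^typ>\<open>enat\<close> the infimum over the empty decomposition is \<open>\<infinity>\<close>, so the zero module has
  Stanley depth \<open>\<infinity>\<close>. For a nonzero module all the values below are at most \<open>card V\<close>, so
  that the supremum is a maximum.
\<close>

definition sdepth_decomposition :: "('m \<times> 'v set) set \<Rightarrow> enat" where
  "sdepth_decomposition D = (INF (u, Z)\<in>D. enat (card Z))"

definition sdepth ::
    "'v set \<Rightarrow> (('v, 'k::field) mpoly, 'm) module \<Rightarrow> (('v \<Rightarrow> int) \<Rightarrow> 'm set) \<Rightarrow> enat" where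
  "sdepth V M gr = (SUP D\<in>{D. stanley_decomposition V M gr D}. sdepth_decomposition D)"


section \<open>Ideals and their quotients as multigraded modules\<close>

definition poly_component :: "'v set \<Rightarrow> ('v \<Rightarrow> int) \<Rightarrow> ('v, 'k::field) mpoly set" where
  "poly_component V a =
     {p \<in> polys_in V. \<forall>m\<in>Poly_Mapping.keys p. \<forall>v. int (Poly_Mapping.lookup m v) = a v}"

definition ideal_module ::
    "('v, 'k::field) mpoly set \<Rightarrow> (('v, 'k) mpoly, ('v, 'k) mpoly) module" where
  "ideal_module I =
     \<lparr>carrier = I, monoid.mult = (*), one = 1, ring.zero = 0, add = (+), smult = (*)\<rparr>"

definition ideal_component ::
    "'v set \<Rightarrow> ('v, 'k::field) mpoly set \<Rightarrow> ('v \<Rightarrow> int) \<Rightarrow> ('v, 'k) mpoly set" where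
  "ideal_component V I a = I \<inter> poly_component V a"

definition quotient_module ::
    "'v set \<Rightarrow> ('v, 'k::field) mpoly set \<Rightarrow> (('v, 'k) mpoly, ('v, 'k) mpoly set) module" where
  "quotient_module V I = (let S = poly_ring V; Q = S Quot I in
     \<lparr>carrier = carrier Q, monoid.mult = monoid.mult Q, one = one Q,
      ring.zero = ring.zero Q, add = add Q,
      smult = (\<lambda>p X. (I +>\<^bsub>S\<^esub> p) \<otimes>\<^bsub>Q\<^esub> X)\<rparr>)"

definition quotient_component ::
    "'v set \<Rightarrow> ('v, 'k::field) mpoly set \<Rightarrow> ('v \<Rightarrow> int) \<Rightarrow> ('v, 'k) mpoly set set" where
  "quotient_component V I a = (\<lambda>p. I +>\<^bsub>poly_ring V\<^esub> p) ` poly_component V a"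

definition sdepth_ideal :: "'v set \<Rightarrow> ('v, 'k::field) mpoly set \<Rightarrow> enat" where
  "sdepth_ideal V I = sdepth V (ideal_module I) (ideal_component V I)"

definition sdepth_quotient :: "'v set \<Rightarrow> ('v, 'k::field) mpoly set \<Rightarrow> enat" where
  "sdepth_quotient V I = sdepth V (quotient_module V I) (quotient_component V I)"

end

theory Submission
  imports Defs
begin

text \<open>
  Let \<open>A\<close>, \<open>B\<close> be the two sides of \<open>G\<close>. A monomial \<open>x\<^sup>a\<close> lies in \<open>J(G)\<^sup>k\<close> iff \<open>a\<^sub>i + a\<^sub>j \<ge> k\<close> on every
  edge. Let \<open>l\<close> be lower bounds on the exponents, and pick a non-isolated \<open>i \<in> A\<close> with \<open>l i\<close> minimal.
  If \<open>l i \<ge> k\<close>, all edge conditions hold. Otherwise split into \<open>a\<^sub>i > l i\<close>, which raises a bound,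
  and \<open>a\<^sub>i = l i\<close>, which freezes \<open>i\<close>. In the latter case \<open>x\<^sup>a \<in> J(G)\<^sup>k\<close> forces \<open>a\<^sub>j \<ge> k - l i\<close> for
  all neighbours \<open>j\<close> of \<open>i\<close>; by minimality of \<open>l i\<close> this settles every edge at such a \<open>j\<close>, so the
  recursion continues with the graph without \<open>N[i]\<close>, whose ordered matchings can be extended by an
  edge at \<open>i\<close>. Hence at most \<open>\<nu>\<^sub>o(G)\<close> exponents are frozen in each box. For the complement, the points
  with \<open>a\<^sub>i = l i\<close> and some \<open>a\<^sub>j < k - l i\<close> are covered by freezing one neighbour in addition.
\<close>

section \<open>Partitions into boxes\<close>

text \<open>The exponent vectors of the monomials in \<open>x^l K[Z]\<close>. Plain functions allow
  bounds to be changed by function update; finite support is recovered in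
  \<open>box_decomp_mon_box\<close>.\<close>

definition box :: "('v \<Rightarrow> nat) \<Rightarrow> 'v set \<Rightarrow> ('v \<Rightarrow> nat) set" where
  "box l Z = {a. \<forall>v. l v \<le> a v \<and> (v \<notin> Z \<longrightarrow> a v = l v)}"

lemma box_le: "a \<in> box l Z \<Longrightarrow> l v \<le> a v"
  and box_eq: "a \<in> box l Z \<Longrightarrow> v \<notin> Z \<Longrightarrow> a v = l v"
  by (simp_all add: box_def)

text \<open>A predicate on the set of points, so that disjoint pieces can be glued without carrying
  index families through the recursion; \<open>d\<close> limits the number of frozen coordinates of
  each box.\<close>

inductive box_decomp :: "'v set \<Rightarrow> nat \<Rightarrow> ('v \<Rightarrow> nat) set \<Rightarrow> bool" for V d where
  empty: "box_decomp V d {}"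
| insert: "box_decomp V d X \<Longrightarrow> Z \<subseteq> V \<Longrightarrow> card (V - Z) \<le> d \<Longrightarrow> box l Z \<inter> X = {} \<Longrightarrow>
     box_decomp V d (box l Z \<union> X)"

lemma box_decomp_box: "Z \<subseteq> V \<Longrightarrow> card (V - Z) \<le> d \<Longrightarrow> box_decomp V d (box l Z)"
  using box_decomp.insert[OF box_decomp.empty] by fastforce

lemma box_decomp_Un:
  "box_decomp V d X \<Longrightarrow> box_decomp V d Y \<Longrightarrow> X \<inter> Y = {} \<Longrightarrow> box_decomp V d (X \<union> Y)"
proof (induction rule: box_decomp.induct)
  case (insert X Z l)
  then have "box_decomp V d (X \<union> Y)"
    by blast
  then show ?case
    using box_decomp.insert[of V d "X \<union> Y" Z l] insert by (simp add: Un_assoc Int_Un_distrib Int_Un_distrib2)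
qed simp

lemma box_decomp_mono: "box_decomp V d X \<Longrightarrow> d \<le> d' \<Longrightarrow> box_decomp V d' X"
  by (induction rule: box_decomp.induct) (auto intro: box_decomp.intros)

lemma box_decomp_UN:
  assumes "finite I" "\<And>c. c \<in> I \<Longrightarrow> box_decomp V d (X c)" "disjoint_family_on X I"
  shows "box_decomp V d (\<Union>c\<in>I. X c)"
  using assms
proof (induction I rule: finite_induct)
  case (insert c I)
  have "box_decomp V d (X c \<union> (\<Union>c\<in>I. X c))"
  proof (rule box_decomp_Un)
    show "box_decomp V d (\<Union>c\<in>I. X c)"
      using insert by (simp add: disjoint_family_on_def)
    show "X c \<inter> (\<Union>c\<in>I. X c) = {}"
      using insert.prems(2) insert.hyps(2) unfolding disjoint_family_on_def by auto
  qed (use insert in simp)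
  then show ?case by simp
qed (simp add: box_decomp.empty)

text \<open>Extracts an explicit family of boxes. Uniqueness persists because the earlier boxes all
  lie inside \<open>X\<close>, which the new box avoids.\<close>

lemma box_decomp_partition:
  assumes "box_decomp V d X"
  shows "\<exists>B. finite B \<and> (\<forall>(u, Z)\<in>B. Z \<subseteq> V \<and> card (V - Z) \<le> d \<and> box u Z \<subseteq> X) \<and>
    (\<forall>a\<in>X. \<exists>!b. b \<in> B \<and> a \<in> case_prod box b)"
  using assms
proof (induction rule: box_decomp.induct)
  case empty
  show ?case by (rule exI[of _ "{}"]) simp
next
  case (insert X Z l)
  from insert.IH obtain B where "finite B \<and>
    (\<forall>(u, Z)\<in>B. Z \<subseteq> V \<and> card (V - Z) \<le> d \<and> box u Z \<subseteq> X) \<and>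
    (\<forall>a\<in>X. \<exists>!b. b \<in> B \<and> a \<in> case_prod box b)" ..
  note B = this[THEN conjunct1] this[THEN conjunct2, THEN conjunct1]
    this[THEN conjunct2, THEN conjunct2]
  have sub: "case_prod box b \<subseteq> X" if "b \<in> B" for b
    using B(2) that by (cases b) auto
  show ?case
  proof (intro exI[of _ "Set.insert (l, Z) B"] conjI ballI)
    show "finite (Set.insert (l, Z) B)" using B(1) by simp
    show "case b of (u, Z') \<Rightarrow> Z' \<subseteq> V \<and> card (V - Z') \<le> d \<and> box u Z' \<subseteq> box l Z \<union> X"
      if "b \<in> Set.insert (l, Z) B" for b
    proof (cases "b = (l, Z)")
      case False
      then have "case b of (u, Z') \<Rightarrow> Z' \<subseteq> V \<and> card (V - Z') \<le> d \<and> box u Z' \<subseteq> X"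
        using that B(2) by blast
      then show ?thesis by auto
    qed (use insert.hyps in simp)
    fix a assume "a \<in> box l Z \<union> X"
    then consider "a \<in> box l Z" "a \<notin> X" | "a \<in> X" "a \<notin> box l Z"
      using insert.hyps by blast
    then show "\<exists>!b. b \<in> Set.insert (l, Z) B \<and> a \<in> case_prod box b"
    proof cases
      case 1
      show ?thesis
      proof (rule ex1I[of _ "(l, Z)"])
        show "b = (l, Z)" if "b \<in> Set.insert (l, Z) B \<and> a \<in> case_prod box b" for b
          using that sub 1 by blast
      qed (use 1 in simp)
    next
      case 2
      from B(3)[rule_format, OF 2(1)] obtain b where b: "b \<in> B" "a \<in> case_prod box b"
        "\<And>b'. b' \<in> B \<and> a \<in> case_prod box b' \<Longrightarrow> b' = b" by blast
      show ?thesis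
      proof (rule ex1I[of _ b])
        show "b' = b" if "b' \<in> Set.insert (l, Z) B \<and> a \<in> case_prod box b'" for b'
        proof -
          have "b' \<noteq> (l, Z)" using that 2 by auto
          then show ?thesis using that b(3) by blast
        qed
      qed (use b in blast)
    qed
  qed
qed

section \<open>Splitting boxes and raising their bounds\<close>

lemma box_split:
  assumes "i \<in> F"
  shows "box l F = box l (F - {i}) \<union> box (l(i := Suc (l i))) F"
    and "box l (F - {i}) \<inter> box (l(i := Suc (l i))) F = {}"
proof -
  have "a \<in> box l F \<longleftrightarrow> a \<in> box l (F - {i}) \<or> a \<in> box (l(i := Suc (l i))) F" for a
  proof (cases "a i = l i")
    case True
    then have "a \<notin> box (l(i := Suc (l i))) F" using box_le[of a "l(i := Suc (l i))" F i] by auto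
    moreover have "a \<in> box l F \<longleftrightarrow> a \<in> box l (F - {i})" using True by (auto simp: box_def)
    ultimately show ?thesis by blast
  next
    case False
    then have "a \<notin> box l (F - {i})" using box_eq[of a l "F - {i}" i] by auto
    moreover have "l i \<le> a i \<longleftrightarrow> Suc (l i) \<le> a i" using False by linarith
    then have "a \<in> box l F \<longleftrightarrow> a \<in> box (l(i := Suc (l i))) F"
      using assms unfolding box_def mem_Collect_eq by (metis fun_upd_apply)
    ultimately show ?thesis by blast
  qed
  then show "box l F = box l (F - {i}) \<union> box (l(i := Suc (l i))) F" by blast
  have "a i = l i" "Suc (l i) \<le> a i" if "a \<in> box l (F - {i})" "a \<in> box (l(i := Suc (l i))) F" for a
    using that box_eq[of a l "F - {i}" i] box_le[of a "l(i := Suc (l i))" F i] by auto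
  then show "box l (F - {i}) \<inter> box (l(i := Suc (l i))) F = {}" by fastforce
qed

text \<open>A lower bound on free coordinates only moves the corner of the box. On a frozen
  coordinate it would instead be a condition on \<open>l\<close>, hence
  \<open>N \<subseteq> F\<close>.\<close>

lemma box_raise:
  assumes "N \<subseteq> F"
  shows "box l F \<inter> {a. \<forall>j\<in>N. t \<le> a j} = box (\<lambda>v. if v \<in> N then max (l v) t else l v) F"
    (is "?L = box ?l F")
proof (intro equalityI subsetI)
  show "a \<in> box ?l F" if "a \<in> ?L" for a
    using that assms by (auto simp: box_def)
  fix a assume a: "a \<in> box ?l F"
  have "l v \<le> a v" for v using box_le[OF a, of v] by (simp split: if_splits)
  moreover have "t \<le> a v" if "v \<in> N" for v using box_le[OF a, of v] that by simp
  moreover have "a v = l v" if "v \<notin> F" for v using box_eq[OF a that] that assms by auto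
  ultimately show "a \<in> ?L" by (simp add: box_def)
qed

text \<open>The points violating a bound are sorted by the first violated coordinate, which is the only
  coordinate that has to be frozen.\<close>
lemma box_decomp_violate:
  assumes "finite N" "N \<subseteq> F" "F \<subseteq> V" "finite V"
  shows "box_decomp V (card (V - F) + 1) (box l F \<inter> {a. \<exists>j\<in>N. a j < (t::nat)})"
  using assms(1,2)
proof (induction N arbitrary: l rule: finite_induct)
  case empty
  then show ?case by (simp add: box_decomp.empty)
next
  case (insert j N)
  define l' where "l' = l(j := max (l j) t)"
  have jF: "j \<in> F" using insert.prems by simp
  have card: "card (V - (F - {j})) \<le> card (V - F) + 1"
  proof -
    have "V - (F - {j}) = Set.insert j (V - F)" using jF assms(3) by auto
    then show ?thesis by (simp add: card_insert_if assms(4) jF)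
  qed
  \<comment> \<open>One slice for each violating value \<open>c\<close> of the exponent at
    \<open>j\<close>: there are finitely many, and each freezes \<open>j\<close> alone.\<close>
  let ?low = "\<Union>c\<in>{l j..<t}. box (l(j := c)) (F - {j})"
  have low: "?low = box l F \<inter> {a. a j < t}"
  proof (intro equalityI subsetI)
    fix a assume "a \<in> ?low"
    then obtain c where c: "l j \<le> c" "c < t" and a: "a \<in> box (l(j := c)) (F - {j})" by auto
    have "a j = c" using box_eq[OF a, of j] by simp
    moreover have "l v \<le> a v" for v using box_le[OF a, of v] c(1) by (cases "v = j") simp_all
    moreover have "a v = l v" if "v \<notin> F" for v using box_eq[OF a, of v] that jF by auto
    ultimately show "a \<in> box l F \<inter> {a. a j < t}" using c by (simp add: box_def)
  next
    fix a assume a: "a \<in> box l F \<inter> {a. a j < t}"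
    then have "a \<in> box (l(j := a j)) (F - {j})" by (simp add: box_def)
    moreover have "l j \<le> a j" "a j < t" using a by (simp_all add: box_def)
    ultimately show "a \<in> ?low" by (intro UN_I[of "a j"]) simp_all
  qed
  have high: "box l' F = box l F \<inter> {a. t \<le> a j}"
    using box_raise[of "{j}" F l t] jF by (simp add: l'_def fun_upd_def if_distrib cong: if_cong)
  have "box_decomp V (card (V - F) + 1) ?low"
  proof (rule box_decomp_UN)
    show "box_decomp V (card (V - F) + 1) (box (l(j := c)) (F - {j}))" for c
      using card assms(3) by (intro box_decomp_box) auto
    show "disjoint_family_on (\<lambda>c. box (l(j := c)) (F - {j})) {l j..<t}"
      unfolding disjoint_family_on_def
    proof (intro ballI impI, rule ccontr)
      fix c c' assume "c \<noteq> c'" "box (l(j := c)) (F - {j}) \<inter> box (l(j := c')) (F - {j}) \<noteq> {}"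
      then obtain a where "a \<in> box (l(j := c)) (F - {j})" "a \<in> box (l(j := c')) (F - {j})" by blast
      then have "a j = c" "a j = c'" by (auto dest: box_eq[of _ _ _ j])
      with \<open>c \<noteq> c'\<close> show False by simp
    qed
  qed simp
  \<comment> \<open>The other points meet the bound at \<open>j\<close>. The corner
    \<open>l'\<close> records this without freezing \<open>j\<close>, so the induction hypothesis
    costs no additional coordinate.\<close>
  moreover have "box_decomp V (card (V - F) + 1) (box l' F \<inter> {a. \<exists>j\<in>N. a j < t})"
    using insert by simp
  ultimately have "box_decomp V (card (V - F) + 1) (?low \<union> (box l' F \<inter> {a. \<exists>j\<in>N. a j < t}))"
    by (rule box_decomp_Un) (unfold low high, auto)
  also have "?low \<union> (box l' F \<inter> {a. \<exists>j\<in>N. a j < t}) = box l F \<inter> {a. \<exists>j\<in>Set.insert j N. a j < t}"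
    unfolding low high by (auto simp: not_less)
  finally show ?case .
qed

section \<open>Ordered matchings and the recursion\<close>

text \<open>Lists of edges in reverse order of an ordered matching of the bipartite graph \<open>R\<close>.\<close>
fun triangular :: "('v \<times> 'v) set \<Rightarrow> ('v \<times> 'v) list \<Rightarrow> bool" where
  "triangular R [] \<longleftrightarrow> True"
| "triangular R ((a, b) # ps) \<longleftrightarrow> (a, b) \<in> R \<and> (\<forall>(c, d)\<in>set ps. (a, d) \<notin> R) \<and> triangular R ps"

lemma triangular_subset: "triangular R ps \<Longrightarrow> set ps \<subseteq> R"
  by (induction ps) auto

text \<open>Edges are deleted according to their second endpoint. All second endpoints in
  \<open>ps\<close> lie outside the neighbourhood of \<open>i\<close>, so a non-edge between
  vertices of \<open>ps\<close> in the smaller graph is a non-edge of \<open>R\<close>, and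
  \<open>i\<close> is adjacent to none of these endpoints.\<close>

lemma triangular_extend:
  assumes "triangular {(c, d) \<in> R. d \<notin> R `` {i}} ps" "(i, j) \<in> R"
  shows "triangular R ((i, j) # ps)"
proof -
  let ?R' = "{(c, d) \<in> R. d \<notin> R `` {i}}"
  have "triangular R ps"
    using assms(1)
  proof (induction ps)
    case (Cons p ps)
    obtain a b where p: "p = (a, b)" by fastforce
    have "(a, d) \<notin> R" if "(c, d) \<in> set ps" for c d
    proof -
      have "(c, d) \<in> ?R'" using that Cons.prems triangular_subset[of ?R' ps] by (auto simp: p)
      moreover have "(a, d) \<notin> ?R'" using Cons.prems that unfolding p by fastforce
      ultimately show ?thesis by blast
    qed
    then show ?case using Cons by (auto simp: p)
  qed simp
  then show ?thesis using assms triangular_subset[OF assms(1)] by auto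
qed

lemma box_decomp_edges:
  fixes l :: "'v \<Rightarrow> nat"
  assumes "finite V" "A \<union> B = V" "A \<inter> B = {}" "R \<subseteq> A \<times> B" "D \<subseteq> V"
    "D \<inter> Domain R = {}" "D \<inter> Range R = {}" "\<And>ps. triangular R ps \<Longrightarrow> length ps \<le> d"
  shows "box_decomp V (card D + d) (box l (V - D) \<inter> {a. \<forall>(i, j)\<in>R. k \<le> a i + a j}) \<and>
    box_decomp V (card D + d + 1) (box l (V - D) \<inter> {a. \<exists>(i, j)\<in>R. a i + a j < k})"
  using assms(4-)
proof (induction "\<Sum>i\<in>Domain R. k - l i" arbitrary: R l D d rule: less_induct)
  case less
  note RAB = less.prems(1) and DV = less.prems(2) and DR = less.prems(3,4) and tri = less.prems(5)
  have finV: "finite X" if "X \<subseteq> V" for X using assms(1) that finite_subset by blast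
  have finDom: "finite (Domain R)" using RAB assms(2) by (intro finV) auto
  have VVD: "V - (V - D) = D" using DV by blast
  show ?case
  \<comment> \<open>If every bound on the \<open>A\<close> side has reached \<open>k\<close>, the
    box contains no bad point; this includes the case of an empty \<open>R\<close>.\<close>
  proof (cases "\<exists>i\<in>Domain R. l i < k")
    case False
    have "k \<le> a i + a j" if "a \<in> box l (V - D)" "(i, j) \<in> R" for a i j
    proof -
      have "l i \<le> a i" using that(1) by (rule box_le)
      moreover have "\<not> l i < k" using False that(2) by blast
      ultimately show ?thesis by simp
    qed
    then have all: "\<forall>(i, j)\<in>R. k \<le> a i + a j" if "a \<in> box l (V - D)" for a
      using that by blast
    have "box l (V - D) \<inter> {a. \<forall>(i, j)\<in>R. k \<le> a i + a j} = box l (V - D)"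
      using all by (intro Int_absorb2 subsetI CollectI)
    moreover have "\<not> (\<exists>(i, j)\<in>R. a i + a j < k)" if "a \<in> box l (V - D)" for a
      using all[OF that] by (auto simp: not_less)
    then have "box l (V - D) \<inter> {a. \<exists>(i, j)\<in>R. a i + a j < k} = {}"
      by (intro Int_emptyI) (simp only: mem_Collect_eq)
    ultimately show ?thesis
      using box_decomp_box[of "V - D" V "card D + d" l] box_decomp.empty[of V "card D + d + 1"] VVD
      by simp
  next
    case True
    define i where "i = arg_min_on l (Domain R)"
    have ne: "Domain R \<noteq> {}" using True by blast
    have i: "i \<in> Domain R" unfolding i_def by (rule arg_min_if_finite(1)[OF finDom ne])
    have imin: "l i \<le> l i'" if "i' \<in> Domain R" for i'
      unfolding i_def by (rule arg_min_least[OF finDom ne that])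
    obtain i' where "i' \<in> Domain R" "l i' < k" using True by blast
    then have lik: "l i < k" using imin[of i'] by simp
    have iA: "i \<in> A" using i RAB by blast
    have iV: "i \<in> V - D" using iA i DR assms(2) by blast
    define N where "N = R `` {i}"
    have NF: "N \<subseteq> V - D - {i}" using RAB DR assms(2,3) iA by (auto simp: N_def)
    \<comment> \<open>Once \<open>a i = l i\<close>, the edges at \<open>i\<close> demand at least
      \<open>t\<close> from each neighbour. The subtraction is exact by \<open>lik\<close>.\<close>
    define t where "t = k - l i"
    define R' where "R' = {(c, d) \<in> R. d \<notin> N}"
    define D' where "D' = Set.insert i D"
    define l' where "l' = l(i := Suc (l i))"
    define l'' where "l'' = (\<lambda>v. if v \<in> N then max (l v) t else l v)"
    have VD': "V - D - {i} = V - D'" by (auto simp: D'_def)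
    have cD': "card D' = card D + 1" using finV[OF DV] iV by (simp add: D'_def)
    obtain j0 where j0: "(i, j0) \<in> R" using i by blast
    have d1: "1 \<le> d" using tri[of "[(i, j0)]"] j0 by simp
    let ?good = "\<lambda>R. {a. \<forall>(i, j)\<in>R. k \<le> a i + (a j :: nat)}"
    let ?bad = "\<lambda>R. {a. \<exists>(i, j)\<in>R. a i + a j < (k :: nat)}"
    \<comment> \<open>The branch \<open>a i > l i\<close>: graph and frozen set are unchanged, and
      the deficit at \<open>i\<close> drops because \<open>l i < k\<close>.\<close>
    have up: "box_decomp V (card D + d) (box l' (V - D) \<inter> ?good R) \<and>
        box_decomp V (card D + d + 1) (box l' (V - D) \<inter> ?bad R)"
    proof (rule less.hyps[OF _ RAB DV DR tri])
      show "(\<Sum>i\<in>Domain R. k - l' i) < (\<Sum>i\<in>Domain R. k - l i)"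
        by (rule sum_strict_mono_ex1) (use finDom i lik in \<open>auto simp: l'_def intro!: bexI[of _ i]\<close>)
    qed
    have sub: "Domain R' \<subseteq> Domain R - {i}" by (auto simp: R'_def N_def)
    have frozen: "box_decomp V (card D' + (d - 1)) (box l'' (V - D') \<inter> ?good R') \<and>
        box_decomp V (card D' + (d - 1) + 1) (box l'' (V - D') \<inter> ?bad R')"
    proof (rule less.hyps)
      \<comment> \<open>Raising bounds on \<open>N\<close> does not affect the measure, since
        \<open>N\<close> lies in \<open>B\<close> and the sum runs over vertices of
        \<open>A\<close>; the positive term of \<open>i\<close> disappears.\<close>
      have "(\<Sum>i\<in>Domain R'. k - l'' i) = (\<Sum>i\<in>Domain R'. k - l i)"
      proof (rule sum.cong)
        fix c assume "c \<in> Domain R'"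
        then have "c \<notin> N" using RAB assms(3) by (auto simp: R'_def N_def)
        then show "k - l'' c = k - l c" by (simp add: l''_def)
      qed simp
      also have "\<dots> \<le> (\<Sum>i\<in>Domain R - {i}. k - l i)"
        by (rule sum_mono2) (use finDom sub in auto)
      also have "\<dots> < (\<Sum>i\<in>Domain R. k - l i)"
        using sum.remove[OF finDom i, of "\<lambda>i. k - l i"] lik by simp
      finally show "(\<Sum>i\<in>Domain R'. k - l'' i) < (\<Sum>i\<in>Domain R. k - l i)" .
      show "R' \<subseteq> A \<times> B" using RAB by (auto simp: R'_def)
      show "D' \<subseteq> V" using DV iV by (auto simp: D'_def)
      show "D' \<inter> Domain R' = {}" using DR sub unfolding D'_def by blast
      show "D' \<inter> Range R' = {}" using DR iA assms(3) RAB unfolding D'_def R'_def by blast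
      \<comment> \<open>Every triangular list of \<open>R'\<close> can be prolonged by an edge at
        \<open>i\<close>, which lowers the bound by one.\<close>
      fix ps assume "triangular R' ps"
      then have "triangular R ((i, j0) # ps)"
        using triangular_extend[OF _ j0] by (simp add: R'_def N_def)
      from tri[OF this] show "length ps \<le> d - 1" by simp
    qed
    have cd: "card D' + (d - 1) = card D + d" using cD' d1 by simp
    have low: "box l (V - D - {i}) \<inter> {a. \<forall>j\<in>N. t \<le> a j} = box l'' (V - D')"
      using box_raise[OF NF, of l t] by (simp add: l''_def VD')
    have ai: "a i = l i" if "a \<in> box l (V - D - {i})" for a
      using box_eq[OF that, of i] by simp
    \<comment> \<open>Since \<open>l i\<close> is minimal, the bound on the neighbours of \<open>i\<close> settles all edges at these
      neighbours, not only those at \<open>i\<close>.\<close>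
    have settled: "k \<le> a c + a e" if "a \<in> box l'' (V - D')" "(c, e) \<in> R - R'" for a c e
    proof -
      have e: "e \<in> N" and c: "c \<in> Domain R" using that(2) by (auto simp: R'_def)
      have a: "a \<in> box l (V - D - {i})" "t \<le> a e" using that(1) e unfolding low[symmetric] by auto
      have "l c \<le> a c" using a(1) by (rule box_le)
      then show ?thesis using imin[OF c] a(2) by (simp add: t_def)
    qed
    have R'R: "R' \<subseteq> R" by (auto simp: R'_def)
    \<comment> \<open>In the slice \<open>a i = l i\<close>, the conditions at \<open>i\<close> say
      exactly that the neighbours reach \<open>t\<close>; then \<open>settled\<close> leaves only
      the edges of \<open>R'\<close>.\<close>
    have good_eq: "box l (V - D - {i}) \<inter> ?good R = box l'' (V - D') \<inter> ?good R'"
    proof (intro equalityI subsetI)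
      fix a assume a: "a \<in> box l (V - D - {i}) \<inter> ?good R"
      then have "\<forall>j\<in>N. t \<le> a j" using ai[of a] by (fastforce simp: N_def t_def)
      then show "a \<in> box l'' (V - D') \<inter> ?good R'" using a R'R unfolding low[symmetric] by blast
    next
      fix a assume a: "a \<in> box l'' (V - D') \<inter> ?good R'"
      then show "a \<in> box l (V - D - {i}) \<inter> ?good R"
        using settled[of a] unfolding low[symmetric] by blast
    qed
    \<comment> \<open>Either some neighbour of \<open>i\<close> stays below \<open>t\<close>, or all
      edges outside \<open>R'\<close> are settled and the violated edge must belong to
      \<open>R'\<close>.\<close>
    have bad_eq: "box l (V - D - {i}) \<inter> ?bad R =
        (box l (V - D - {i}) \<inter> {a. \<exists>j\<in>N. a j < t}) \<union> (box l'' (V - D') \<inter> ?bad R')"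
    proof (intro equalityI subsetI)
      fix a assume a: "a \<in> box l (V - D - {i}) \<inter> ?bad R"
      show "a \<in> (box l (V - D - {i}) \<inter> {a. \<exists>j\<in>N. a j < t}) \<union> (box l'' (V - D') \<inter> ?bad R')"
      proof (cases "\<exists>j\<in>N. a j < t")
        case False
        then have "a \<in> box l'' (V - D')" using a unfolding low[symmetric] by (auto simp: not_less)
        moreover have "\<exists>(c, e)\<in>R'. a c + a e < k"
          using a settled[OF calculation] leD by blast
        ultimately show ?thesis by blast
      qed (use a in auto)
    next
      fix a assume "a \<in> (box l (V - D - {i}) \<inter> {a. \<exists>j\<in>N. a j < t}) \<union> (box l'' (V - D') \<inter> ?bad R')"
      then show "a \<in> box l (V - D - {i}) \<inter> ?bad R"
      proof
        assume a: "a \<in> box l (V - D - {i}) \<inter> {a. \<exists>j\<in>N. a j < t}"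
        then obtain j where j: "(i, j) \<in> R" "a j < t" by (auto simp: N_def)
        then have "a i + a j < k" using ai[of a] a lik by (simp add: t_def)
        then show ?thesis using a j by auto
      next
        assume "a \<in> box l'' (V - D') \<inter> ?bad R'"
        then show ?thesis using R'R unfolding low[symmetric] by blast
      qed
    qed
    have "box_decomp V (card D + d) ((box l'' (V - D') \<inter> ?good R') \<union> (box l' (V - D) \<inter> ?good R))"
      using up frozen box_split(2)[OF iV, of l] unfolding good_eq[symmetric] l'_def[symmetric] cd
      by (intro box_decomp_Un) auto
    then have 1: "box_decomp V (card D + d) (box l (V - D) \<inter> ?good R)"
      unfolding good_eq[symmetric] box_split(1)[OF iV, of l] l'_def[symmetric] Int_Un_distrib2 .
    \<comment> \<open>Here \<open>i\<close> and one neighbour are frozen on top of \<open>D\<close>.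
      These two coordinates fit into \<open>d + 1\<close> because \<open>d\<close> is at least
      1.\<close>
    have viol: "box_decomp V (card D + d + 1) (box l (V - D - {i}) \<inter> {a. \<exists>j\<in>N. a j < t})"
    proof (rule box_decomp_mono)
      show "box_decomp V (card (V - (V - D - {i})) + 1) (box l (V - D - {i}) \<inter> {a. \<exists>j\<in>N. a j < t})"
        using NF finV[of N] assms(1) by (intro box_decomp_violate) auto
      have "V - (V - D - {i}) = D'" using DV iV by (auto simp: D'_def)
      then show "card (V - (V - D - {i})) + 1 \<le> card D + d + 1" using cD' d1 by simp
    qed
    have "box_decomp V (card D + d + 1) (box l (V - D - {i}) \<inter> ?bad R)"
      unfolding bad_eq using viol frozen unfolding cd
      by (intro box_decomp_Un) (auto simp: low[symmetric])
    then have "box_decomp V (card D + d + 1)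
        ((box l (V - D - {i}) \<inter> ?bad R) \<union> (box l' (V - D) \<inter> ?bad R))"
      using up box_split(2)[OF iV, of l] unfolding l'_def[symmetric]
      by (intro box_decomp_Un) auto
    then have "box_decomp V (card D + d + 1) (box l (V - D) \<inter> ?bad R)"
      unfolding box_split(1)[OF iV, of l] l'_def[symmetric] Int_Un_distrib2 .
    with 1 show ?thesis by blast
  qed
qed

text \<open>If the pairs with indices \<open>i\<close> and \<open>j\<close> share a vertex, then
  both \<open>(a i, b j)\<close> and \<open>(a j, b i)\<close> are edges, and the order condition
  gives \<open>i \<le> j\<close> and \<open>j \<le> i\<close>. Hence the edges are disjoint and none
  is counted twice.\<close>

lemma triangular_ordered_matching:
  assumes "triangular R ps" "ps \<noteq> []" and R_eq: "R = {(i, j). i \<in> A \<and> j \<in> B \<and> {i, j} \<in> E}"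
    and "A \<inter> B = {}" and indep: "independent_set E A"
  shows "ordered_matching E ((\<lambda>(a, b). {a, b}) ` set ps)"
    and "card ((\<lambda>(a, b). {a, b}) ` set ps) = length ps"
proof -
  have RAB: "R \<subseteq> A \<times> B" using R_eq by auto
  have R: "(i, j) \<in> R \<longleftrightarrow> {i, j} \<in> E" if "i \<in> A" "j \<in> B" for i j using that R_eq by simp
  define n where "n = length ps"
  \<comment> \<open>Reverses the list and starts the numbering at 1: in \<open>triangular\<close> an
    earlier first endpoint misses all later second endpoints, whereas an ordered matching wants the
    opposite direction.\<close>
  define p where "p i = ps ! (n - i)" for i
  define a where "a = fst \<circ> p"
  define b where "b = snd \<circ> p"
  have tri: "(fst (ps ! x), snd (ps ! y)) \<notin> R" if "x < y" "y < length ps" for x y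
    using assms(1) that
  proof (induction ps arbitrary: x y)
    case (Cons q ps)
    obtain c d where q: "q = (c, d)" by fastforce
    show ?case
    proof (cases x)
      case 0
      obtain y' where y: "y = Suc y'" using Cons.prems by (cases y) auto
      have "ps ! y' \<in> set ps" using Cons.prems y by simp
      then have "case ps ! y' of (c', d') \<Rightarrow> (c, d') \<notin> R" using Cons.prems(1) unfolding q by auto
      then show ?thesis by (simp add: q 0 y case_prod_beta)
    next
      case (Suc x')
      then show ?thesis using Cons by (cases y) (auto simp: q)
    qed
  qed simp
  have mem: "(a i, b i) \<in> R" if "i \<in> {1..n}" for i
  proof -
    have "p i \<in> set ps" using that unfolding p_def by (intro nth_mem) (auto simp: n_def)
    then show ?thesis using triangular_subset[OF assms(1)] by (auto simp: a_def b_def)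
  qed
  have le: "i \<le> j" if "i \<in> {1..n}" "j \<in> {1..n}" "(a i, b j) \<in> R" for i j
  proof (rule ccontr)
    assume "\<not> i \<le> j"
    then have "n - i < n - j" "n - j < length ps" using that by (auto simp: n_def)
    from tri[OF this] show False using that by (simp add: a_def b_def p_def)
  qed
  have ab: "a i \<in> A" "b i \<in> B" if "i \<in> {1..n}" for i using mem[OF that] RAB by auto
  have eq: "i = j" if "i \<in> {1..n}" "j \<in> {1..n}" "{a i, b i} \<inter> {a j, b j} \<noteq> {}" for i j
  proof -
    have "a i = a j \<or> b i = b j" using that ab[of i] ab[of j] assms(4) by auto
    then show ?thesis using mem[of i] mem[of j] le[of i j] le[of j i] that(1,2) by auto
  qed
  let ?e = "\<lambda>i. {a i, b i}"
  have inj: "inj_on ?e {1..n}"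
  proof (rule inj_onI)
    fix i j assume ij: "i \<in> {1..n}" "j \<in> {1..n}" "{a i, b i} = {a j, b j}"
    show "i = j" by (rule eq[OF ij(1,2)]) (simp add: ij(3))
  qed
  have img: "?e ` {1..n} = (\<lambda>(a, b). {a, b}) ` set ps"
  proof -
    have "p ` {1..n} = set ps"
    proof (intro equalityI subsetI)
      fix q assume "q \<in> set ps"
      then obtain m where "m < n" "q = ps ! m" by (auto simp: in_set_conv_nth n_def)
      then have "q = p (n - m)" "n - m \<in> {1..n}" by (auto simp: p_def)
      then show "q \<in> p ` {1..n}" by blast
    next
      fix q assume "q \<in> p ` {1..n}"
      then obtain i where "q = p i" "i \<in> {1..n}" by (rule imageE)
      then show "q \<in> set ps" by (auto simp: p_def n_def intro!: nth_mem)
    qed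
    then have "(\<lambda>(a, b). {a, b}) ` set ps = (\<lambda>i. (\<lambda>(a, b). {a, b}) (p i)) ` {1..n}"
      by (metis image_image)
    then show ?thesis by (simp add: a_def b_def case_prod_beta)
  qed
  have "disjoint (?e ` {1..n})"
    unfolding disjoint_def
  proof (intro ballI impI)
    fix e e' assume e: "e \<in> ?e ` {1..n}" and e': "e' \<in> ?e ` {1..n}" and ne: "e \<noteq> e'"
    from e obtain i where i: "e = {a i, b i}" "i \<in> {1..n}" by (rule imageE)
    from e' obtain j where j: "e' = {a j, b j}" "j \<in> {1..n}" by (rule imageE)
    show "e \<inter> e' = {}"
    proof (rule ccontr)
      assume "e \<inter> e' \<noteq> {}"
      then have "i = j" unfolding i(1) j(1) by (rule eq[OF i(2) j(2)])
      then show False using ne i(1) j(1) by simp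
    qed
  qed
  moreover have "?e ` {1..n} \<subseteq> E" using mem ab R by auto
  moreover have "independent_set E (a ` {1..n})"
    using indep ab unfolding independent_set_def by auto
  moreover have "\<forall>i\<in>{1..n}. \<forall>j\<in>{1..n}. {a i, b j} \<in> E \<longrightarrow> i \<le> j"
    using le R[OF ab(1) ab(2)] by metis
  moreover have "?e ` {1..n} \<noteq> {}" using assms(2) unfolding img by simp
  moreover have "bij_betw ?e {1..n} (?e ` {1..n})" using inj by (rule inj_on_imp_bij_betw)
  ultimately have "ordered_matching E (?e ` {1..n})"
    unfolding ordered_matching_def by (intro conjI exI[of _ n] exI[of _ a] exI[of _ b])
  then show "ordered_matching E ((\<lambda>(a, b). {a, b}) ` set ps)"
    unfolding img .
  show "card ((\<lambda>(a, b). {a, b}) ` set ps) = length ps"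
    using card_image[OF inj] img by (simp add: n_def)
qed

text \<open>Ordered matchings are subsets of the finite set \<open>E\<close>, so the maximum is
  attained over a finite set. A nonempty list forces \<open>E\<close> to be nonempty, which selects
  the \<open>Max\<close> branch of the definition.\<close>

lemma length_triangular_le:
  assumes "triangular R ps" "R = {(i, j). i \<in> A \<and> j \<in> B \<and> {i, j} \<in> E}" "A \<inter> B = {}"
    "independent_set E A" "finite E"
  shows "length ps \<le> ordered_matching_number E"
proof (cases "ps = []")
  case False
  let ?M = "(\<lambda>(a, b). {a, b}) ` set ps"
  note M = triangular_ordered_matching[OF assms(1) False assms(2-4)]
  have len: "length ps \<in> card ` {M. ordered_matching E M}"
    unfolding M(2)[symmetric] using M(1) by (intro imageI CollectI)
  have sub: "M \<subseteq> E" "M \<noteq> {}" if "ordered_matching E M" for M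
    using that[unfolded ordered_matching_def, THEN conjunct1]
      that[unfolded ordered_matching_def, THEN conjunct2, THEN conjunct1] by simp_all
  have "{M. ordered_matching E M} \<subseteq> Pow E"
    by (intro subsetI PowI sub(1)) (rule CollectD)
  then have "finite {M. ordered_matching E M}"
    by (rule finite_subset) (simp add: assms(5))
  with len have "length ps \<le> Max (card ` {M. ordered_matching E M})"
    by (intro Max_ge finite_imageI)
  moreover have "E \<noteq> {}" using sub[OF M(1)] by auto
  ultimately show ?thesis by (simp add: ordered_matching_number_def)
qed simp

section \<open>Polynomials and monomials\<close>

abbreviation keys :: "('a \<Rightarrow>\<^sub>0 'b::zero) \<Rightarrow> 'a set" where "keys \<equiv> Poly_Mapping.keys"
abbreviation lookup :: "('a \<Rightarrow>\<^sub>0 'b::zero) \<Rightarrow> 'a \<Rightarrow> 'b" where "lookup \<equiv> Poly_Mapping.lookup"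

lemma lookup_times_monomial:
  fixes v :: "('v, 'k::field) mpoly"
  shows "lookup (v * Poly_Mapping.single u 1) (z + u) = lookup v z"
proof -
  have "Sum_any (\<lambda>q. lookup (Poly_Mapping.single u (1::'k)) q when z + u = l + q) = (1 when z = l)" for l
  proof -
    have "(\<lambda>q. lookup (Poly_Mapping.single u (1::'k)) q when z + u = l + q) = (\<lambda>q. (1 when z = l) when u = q)"
      by (auto simp: lookup_single when_def fun_eq_iff)
    from arg_cong[OF this, of Sum_any] show ?thesis unfolding Sum_any_when_equal' .
  qed
  then show ?thesis by (simp add: lookup_mult mult_when)
qed

lemma keys_times_monomial:
  "keys (v * Poly_Mapping.single u 1 :: ('v, 'k::field) mpoly) = (\<lambda>z. z + u) ` keys v"
proof
  show "keys (v * Poly_Mapping.single u 1) \<subseteq> (\<lambda>z. z + u) ` keys v"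
    using keys_mult[of v "Poly_Mapping.single u 1"] by auto
  show "(\<lambda>z. z + u) ` keys v \<subseteq> keys (v * Poly_Mapping.single u 1)"
    by (auto simp: in_keys_iff lookup_times_monomial)
qed

lemma polys_in_iff: "p \<in> polys_in Z \<longleftrightarrow> (\<forall>m\<in>keys p. keys m \<subseteq> Z)"
  by (simp add: polys_in_def)

lemma keys_add_nat: "keys (a + b :: 'v \<Rightarrow>\<^sub>0 nat) = keys a \<union> keys b"
  by (auto simp: in_keys_iff lookup_add)

definition mon_box :: "('v \<Rightarrow>\<^sub>0 nat) \<times> 'v set \<Rightarrow> ('v \<Rightarrow>\<^sub>0 nat) set" where
  "mon_box b = {m. lookup m \<in> box (lookup (fst b)) (snd b)}"

text \<open>Links the description by bounds with the monomial multiples of \<open>x^u\<close>. On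
  the box \<open>u\<close> lies below \<open>m\<close>, so the truncated difference
  \<open>m - u\<close> is exact.\<close>

lemma mon_box_eq: "mon_box (u, Z) = (\<lambda>z. z + u) ` {z. keys z \<subseteq> Z}"
proof (intro equalityI subsetI)
  fix m assume m: "m \<in> mon_box (u, Z)"
  then have lm: "lookup m \<in> box (lookup u) Z" by (simp add: mon_box_def)
  have "m = (m - u) + u"
    by (rule poly_mapping_eqI) (simp add: lookup_add lookup_minus box_le[OF lm])
  moreover have "keys (m - u) \<subseteq> Z"
  proof
    fix v assume "v \<in> keys (m - u)"
    then have "lookup m v \<noteq> lookup u v" by (simp add: in_keys_iff lookup_minus)
    then show "v \<in> Z" using box_eq[OF lm] by blast
  qed
  ultimately show "m \<in> (\<lambda>z. z + u) ` {z. keys z \<subseteq> Z}" by blast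
next
  fix m assume "m \<in> (\<lambda>z. z + u) ` {z. keys z \<subseteq> Z}"
  then obtain z where "m = z + u" "keys z \<subseteq> Z" by blast
  then show "m \<in> mon_box (u, Z)"
    by (auto simp: mon_box_def box_def lookup_add in_keys_iff)
qed

text \<open>The \<open>K\<close>-subspace spanned by the monomials with exponents in
  \<open>T\<close>.\<close>

definition mon_span :: "('v \<Rightarrow>\<^sub>0 nat) set \<Rightarrow> ('v, 'k::field) mpoly set" where
  "mon_span T = {p. keys p \<subseteq> T}"

lemma mon_span_0: "0 \<in> mon_span T"
  by (simp add: mon_span_def)

lemma mon_span_add: "p \<in> mon_span T \<Longrightarrow> q \<in> mon_span T \<Longrightarrow> p + q \<in> mon_span T"
  using Poly_Mapping.keys_add[of p q] by (auto simp: mon_span_def)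

lemma mon_span_sum: "(\<And>d. d \<in> D \<Longrightarrow> q d \<in> mon_span T) \<Longrightarrow> sum q D \<in> mon_span T"
  by (induction D rule: infinite_finite_induct) (auto simp: mon_span_0 intro: mon_span_add)

lemma mon_span_mono: "S \<subseteq> T \<Longrightarrow> mon_span S \<subseteq> mon_span T"
  by (auto simp: mon_span_def)

lemma polys_in_eq_mon_span: "polys_in V = mon_span {m. keys m \<subseteq> V}"
  unfolding mon_span_def polys_in_def by blast

text \<open>Division by \<open>x^u\<close> is a shift of coefficients along the injective map
  \<open>z \<mapsto> z + u\<close>; nothing is lost, as all monomials of the box are divisible by
  \<open>x^u\<close>.\<close>

lemma times_monomial_image:
  "(\<lambda>v. v * Poly_Mapping.single u 1) ` polys_in Z = (mon_span (mon_box (u, Z)) :: ('v, 'k::field) mpoly set)"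
proof (intro equalityI subsetI)
  fix p :: "('v, 'k) mpoly" assume "p \<in> (\<lambda>v. v * Poly_Mapping.single u 1) ` polys_in Z"
  then obtain v :: "('v, 'k) mpoly" where "p = v * Poly_Mapping.single u 1" "v \<in> polys_in Z" by blast
  then show "p \<in> mon_span (mon_box (u, Z))"
    by (auto simp: mon_span_def mon_box_eq keys_times_monomial polys_in_iff)
next
  fix p :: "('v, 'k) mpoly" assume p: "p \<in> mon_span (mon_box (u, Z))"
  have inj: "inj (\<lambda>z::'v \<Rightarrow>\<^sub>0 nat. z + u)" by (simp add: inj_def)
  define v where "v = Poly_Mapping.map_key (\<lambda>z. z + u) p"
  have lv: "lookup v z = lookup p (z + u)" for z
    using map_key.rep_eq[OF inj, of p] by (simp add: v_def o_def)
  have "p = v * Poly_Mapping.single u 1"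
  proof (rule poly_mapping_eqI)
    fix m
    show "lookup p m = lookup (v * Poly_Mapping.single u 1) m"
    proof (cases "m \<in> mon_box (u, Z)")
      case True
      then show ?thesis by (auto simp: mon_box_eq lookup_times_monomial lv)
    next
      case False
      then have "m \<notin> keys p" using p by (auto simp: mon_span_def)
      moreover have "m \<notin> keys (v * Poly_Mapping.single u 1)"
        using \<open>m \<notin> keys p\<close> by (auto simp: keys_times_monomial in_keys_iff lv)
      ultimately show ?thesis by (simp add: in_keys_iff)
    qed
  qed
  moreover have "v \<in> polys_in Z"
    unfolding polys_in_iff
  proof
    fix z assume "z \<in> keys v"
    then have "z + u \<in> mon_box (u, Z)" using p by (auto simp: in_keys_iff lv mon_span_def)
    then show "keys z \<subseteq> Z" by (auto simp: mon_box_eq)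
  qed
  ultimately show "p \<in> (\<lambda>v. v * Poly_Mapping.single u 1) ` polys_in Z" by blast
qed

lemma inj_times_monomial: "inj (\<lambda>v. v * Poly_Mapping.single u 1 :: ('v, 'k::field) mpoly)"
proof (rule injI)
  fix v w :: "('v, 'k) mpoly" assume "v * Poly_Mapping.single u 1 = w * Poly_Mapping.single u 1"
  then show "v = w"
    using lookup_times_monomial[of v u] lookup_times_monomial[of w u] by (intro poly_mapping_eqI) metis
qed

section \<open>Stanley decompositions from partitions of monomials\<close>

text \<open>Common setting for a monomial ideal and its quotient: \<open>\<phi>\<close> identifies
  the span of the monomials in \<open>T\<close> with the module. It is the identity for the ideal
  and the coset map for the quotient. \<open>smult\<close> concerns products that stay in the span
  of \<open>T\<close>, as they do inside a box contained in \<open>T\<close>.\<close>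

locale monomial_basis =
  fixes V :: "'v set" and T :: "('v \<Rightarrow>\<^sub>0 nat) set"
    and M :: "(('v, 'k::field) mpoly, 'm) module" and gr :: "('v \<Rightarrow> int) \<Rightarrow> 'm set"
    and \<phi> :: "('v, 'k) mpoly \<Rightarrow> 'm"
  assumes monoid: "abelian_monoid M"
    and bij: "bij_betw \<phi> (mon_span T) (carrier M)"
    and zero: "\<phi> 0 = \<zero>\<^bsub>M\<^esub>"
    and add: "p \<in> mon_span T \<Longrightarrow> q \<in> mon_span T \<Longrightarrow> \<phi> (p + q) = \<phi> p \<oplus>\<^bsub>M\<^esub> \<phi> q"
    and smult: "v \<in> polys_in V \<Longrightarrow> u \<in> T \<Longrightarrow> v * Poly_Mapping.single u 1 \<in> mon_span T \<Longrightarrow>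
      v \<odot>\<^bsub>M\<^esub> \<phi> (Poly_Mapping.single u 1) = \<phi> (v * Poly_Mapping.single u 1)"
    and gr: "u \<in> T \<Longrightarrow> \<phi> (Poly_Mapping.single u 1) \<in> gr (\<lambda>v. int (lookup u v))"
begin

interpretation abelian_monoid M by (rule monoid)

lemma inj: "p \<in> mon_span T \<Longrightarrow> q \<in> mon_span T \<Longrightarrow> \<phi> p = \<phi> q \<Longrightarrow> p = q"
  using bij by (auto simp: bij_betw_def dest: inj_onD)

lemma closed: "p \<in> mon_span T \<Longrightarrow> \<phi> p \<in> carrier M"
  using bij by (auto simp: bij_betw_def)

lemma finsum_eq:
  assumes "finite D" "\<And>d. d \<in> D \<Longrightarrow> q d \<in> mon_span T"
  shows "finsum M (\<lambda>d. \<phi> (q d)) D = \<phi> (sum q D)"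
  using assms
proof (induction D rule: finite_induct)
  case (insert d D)
  then have "finsum M (\<lambda>d. \<phi> (q d)) (Set.insert d D) = \<phi> (q d) \<oplus>\<^bsub>M\<^esub> finsum M (\<lambda>d. \<phi> (q d)) D"
    by (intro finsum_insert) (auto intro: closed)
  also have "\<dots> = \<phi> (q d + sum q D)"
    using insert by (simp add: add mon_span_sum)
  finally show ?case using insert.hyps by simp
qed (simp add: zero)

text \<open>A box inside \<open>T\<close> yields a Stanley space: scalar multiplication transports
  to multiplication by a monomial, which is injective, and \<open>\<phi>\<close> is injective on the
  span of \<open>T\<close>.\<close>

lemma stanley_span_eq:
  assumes "Z \<subseteq> V" "mon_box (u, Z) \<subseteq> T"
  shows "stanley_span M (\<phi> (Poly_Mapping.single u 1), Z) = \<phi> ` mon_span (mon_box (u, Z))"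
    and "stanley_space V M gr (\<phi> (Poly_Mapping.single u 1), Z)"
proof -
  have "u \<in> mon_box (u, Z)" by (simp add: mon_box_def box_def)
  then have uT: "u \<in> T" using assms by blast
  have in_box: "v * Poly_Mapping.single u 1 \<in> mon_span (mon_box (u, Z))" if "v \<in> polys_in Z"
    for v :: "('v, 'k) mpoly"
    using imageI[OF that, of "\<lambda>v. v * Poly_Mapping.single u 1"] unfolding times_monomial_image .
  have sm: "v \<odot>\<^bsub>M\<^esub> \<phi> (Poly_Mapping.single u 1) = \<phi> (v * Poly_Mapping.single u 1)"
    and inT: "v * Poly_Mapping.single u 1 \<in> mon_span T" if "v \<in> polys_in Z" for v
  proof -
    show inT: "v * Poly_Mapping.single u 1 \<in> mon_span T"
      using in_box[OF that] mon_span_mono[OF assms(2)] by blast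
    have "v \<in> polys_in V" using that assms(1) by (auto simp: polys_in_iff)
    then show "v \<odot>\<^bsub>M\<^esub> \<phi> (Poly_Mapping.single u 1) = \<phi> (v * Poly_Mapping.single u 1)"
      by (rule smult[OF _ uT inT])
  qed
  have "stanley_span M (\<phi> (Poly_Mapping.single u 1), Z) =
      (\<lambda>v. v \<odot>\<^bsub>M\<^esub> \<phi> (Poly_Mapping.single u 1)) ` polys_in Z"
    by (auto simp: stanley_span_def)
  also have "\<dots> = \<phi> ` (\<lambda>v. v * Poly_Mapping.single u 1) ` polys_in Z"
    unfolding image_image by (rule image_cong) (simp_all add: sm)
  finally show "stanley_span M (\<phi> (Poly_Mapping.single u 1), Z) = \<phi> ` mon_span (mon_box (u, Z))"
    unfolding times_monomial_image .
  have "inj_on (\<lambda>v. v \<odot>\<^bsub>M\<^esub> \<phi> (Poly_Mapping.single u 1)) (polys_in Z)"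
  proof (rule inj_onI)
    fix v w :: "('v, 'k) mpoly" assume v: "v \<in> polys_in Z" and w: "w \<in> polys_in Z"
      and eq: "v \<odot>\<^bsub>M\<^esub> \<phi> (Poly_Mapping.single u 1) = w \<odot>\<^bsub>M\<^esub> \<phi> (Poly_Mapping.single u 1)"
    have "v * Poly_Mapping.single u 1 = w * Poly_Mapping.single u 1"
      using inj[OF inT[OF v] inT[OF w]] eq unfolding sm[OF v] sm[OF w] .
    then show "v = w" by (rule injD[OF inj_times_monomial])
  qed
  moreover have "\<phi> (Poly_Mapping.single u 1) \<in> carrier M"
    using uT by (intro closed) (simp add: mon_span_def)
  ultimately show "stanley_space V M gr (\<phi> (Poly_Mapping.single u 1), Z)"
    using gr[OF uT] assms(1) unfolding stanley_space_def by blast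
qed

text \<open>A partition of the basis monomials into boxes cuts each polynomial uniquely into pieces
  supported on the boxes, and \<open>\<phi>\<close> carries this over to the module.\<close>

lemma sdepth_ge:
  assumes fin: "finite B"
    and B: "\<And>b. b \<in> B \<Longrightarrow> snd b \<subseteq> V \<and> c \<le> card (snd b) \<and> mon_box b \<subseteq> T"
    and part: "\<And>m. m \<in> T \<Longrightarrow> \<exists>!b. b \<in> B \<and> m \<in> mon_box b"
  shows "enat c \<le> sdepth V M gr"
proof -
  define F where "F b = (\<phi> (Poly_Mapping.single (fst b) 1), snd b)" for b :: "('v \<Rightarrow>\<^sub>0 nat) \<times> 'v set"
  define D where "D = F ` B"
  have base: "fst b \<in> mon_box b" for b :: "('v \<Rightarrow>\<^sub>0 nat) \<times> 'v set"
    by (simp add: mon_box_def box_def)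
  \<comment> \<open>Passing from boxes to generators in the module must not merge two members of the
    family, because decompositions are sets.\<close>
  have injF: "inj_on F B"
  proof (rule inj_onI)
    fix b b' assume b: "b \<in> B" "b' \<in> B" "F b = F b'"
    have "Poly_Mapping.single (fst b) (1::'k) \<in> mon_span T" "Poly_Mapping.single (fst b') (1::'k) \<in> mon_span T"
      using B[OF b(1)] B[OF b(2)] base[of b] base[of b'] by (auto simp: mon_span_def)
    then have "Poly_Mapping.single (fst b) (1::'k) = Poly_Mapping.single (fst b') 1"
      by (rule inj) (use b(3) in \<open>simp add: F_def\<close>)
    then have "fst b \<in> keys (Poly_Mapping.single (fst b') (1::'k))" by (metis keys_single insertI1 one_neq_zero)
    then show "b = b'" using b(3) by (simp add: F_def prod_eq_iff)
  qed
  \<comment> \<open>Recovers the box of a Stanley space from the member of \<open>D\<close> that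
    encodes it.\<close>
  define X where "X d = mon_box (the_inv_into B F d)" for d
  have XF: "X (F b) = mon_box b" if "b \<in> B" for b
    using that by (simp add: X_def the_inv_into_f_f[OF injF])
  have XT: "X d \<subseteq> T" if "d \<in> D" for d
  proof -
    obtain b where b: "b \<in> B" "d = F b" using \<open>d \<in> D\<close> unfolding D_def by blast
    then show ?thesis using B[OF b(1)] XF[OF b(1)] by simp
  qed
  have span: "stanley_span M d = \<phi> ` mon_span (X d)" and space: "stanley_space V M gr d"
    if "d \<in> D" for d
  proof -
    obtain b where b: "b \<in> B" "d = F b" using \<open>d \<in> D\<close> unfolding D_def by blast
    show "stanley_span M d = \<phi> ` mon_span (X d)" "stanley_space V M gr d"
      using B[OF b(1)] stanley_span_eq[of "snd b" "fst b"] unfolding b(2) XF[OF b(1)] by (simp_all add: F_def)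
  qed
  have finD: "finite D" using fin by (simp add: D_def)
  have uniq: "\<exists>d\<in>D. m \<in> X d \<and> (\<forall>d'\<in>D. m \<in> X d' \<longrightarrow> d' = d)" if "m \<in> T" for m
  proof -
    from part[OF that] obtain b where b: "b \<in> B" "m \<in> mon_box b"
      and u: "\<And>b'. b' \<in> B \<and> m \<in> mon_box b' \<Longrightarrow> b' = b" by blast
    have "d' = F b" if d': "d' \<in> D" "m \<in> X d'" for d'
    proof -
      obtain b' where b': "b' \<in> B" "d' = F b'" using d'(1) unfolding D_def by blast
      then show ?thesis using u[of b'] d'(2) XF by simp
    qed
    then show ?thesis using b XF by (intro bexI[of _ "F b"]) (auto simp: D_def)
  qed
  \<comment> \<open>Each monomial lies in one box only, so a single summand contributes to its
    coefficient. This gives both existence and uniqueness below.\<close>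
  have lookup_sum_X: "lookup (sum q D) m = lookup (q d) m"
    if "\<And>d. d \<in> D \<Longrightarrow> q d \<in> mon_span (X d)" "d \<in> D" "m \<in> X d" for m d and q :: "_ \<Rightarrow> ('v, 'k) mpoly"
  proof -
    have "m \<in> T" using XT that(2,3) by blast
    from uniq[OF this] obtain e where e: "\<forall>d'\<in>D. m \<in> X d' \<longrightarrow> d' = e" by blast
    have "lookup (q d') m = 0" if "d' \<in> D - {d}" for d'
    proof -
      have "m \<notin> X d'" using e that \<open>d \<in> D\<close> \<open>m \<in> X d\<close> by blast
      moreover have "keys (q d') \<subseteq> X d'" using \<open>\<And>d. d \<in> D \<Longrightarrow> q d \<in> mon_span (X d)\<close>[of d'] that
        by (simp add: mon_span_def)
      ultimately have "m \<notin> keys (q d')" by blast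
      then show ?thesis by (simp add: in_keys_iff)
    qed
    then show ?thesis
      using sum.remove[OF finD \<open>d \<in> D\<close>, of "\<lambda>d. lookup (q d) m"] by (simp add: lookup_sum)
  qed
  have decomp: "\<exists>!f. f \<in> Pi\<^sub>E D (stanley_span M) \<and> x = finsum M f D" if x: "x \<in> carrier M" for x
  proof -
    obtain p where p: "p \<in> mon_span T" "x = \<phi> p"
      using x bij unfolding bij_betw_def by blast
    \<comment> \<open>The part of \<open>p\<close> supported on the box of \<open>d\<close>.\<close>
    define r where "r d = Poly_Mapping.mapp (\<lambda>m c. c when m \<in> X d) p" for d
    have lr: "lookup (r d) m = (lookup p m when m \<in> X d)" for d m
      by (simp add: r_def lookup_mapp when_def in_keys_iff)
    have rX: "r d \<in> mon_span (X d)" for d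
      by (auto simp: mon_span_def in_keys_iff lr)
    have rT: "r d \<in> mon_span T" if "d \<in> D" for d
      using rX mon_span_mono[OF XT[OF that]] by blast
    have sumr: "sum r D = p"
    proof (rule poly_mapping_eqI)
      fix m
      show "lookup (sum r D) m = lookup p m"
      proof (cases "m \<in> T")
        case True
        from uniq[OF this] obtain d where d: "d \<in> D" "m \<in> X d" by blast
        then show ?thesis using lookup_sum_X[of r, OF rX d] by (simp add: lr)
      next
        case False
        have "sum r D \<in> mon_span T" using rT by (intro mon_span_sum)
        then show ?thesis using False p(1) unfolding mon_span_def by (metis in_keys_iff mem_Collect_eq subsetD)
      qed
    qed
    show ?thesis
    proof (rule ex1I[of _ "\<lambda>d\<in>D. \<phi> (r d)"])
      have "finsum M (\<lambda>d\<in>D. \<phi> (r d)) D = finsum M (\<lambda>d. \<phi> (r d)) D"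
        by (rule finsum_cong') (auto intro: closed rT)
      then have "x = finsum M (\<lambda>d\<in>D. \<phi> (r d)) D"
        using finsum_eq[OF finD rT] sumr p(2) by simp
      moreover have "(\<lambda>d\<in>D. \<phi> (r d)) \<in> Pi\<^sub>E D (stanley_span M)"
        using rX by (simp add: span)
      ultimately show "(\<lambda>d\<in>D. \<phi> (r d)) \<in> Pi\<^sub>E D (stanley_span M) \<and> x = finsum M (\<lambda>d\<in>D. \<phi> (r d)) D"
        by (intro conjI)
    next
      fix f assume f: "f \<in> Pi\<^sub>E D (stanley_span M) \<and> x = finsum M f D"
      have "\<exists>q. q \<in> mon_span (X d) \<and> f d = \<phi> q" if "d \<in> D" for d
        using PiE_mem[OF conjunct1[OF f] that] span[OF that] by auto
      then obtain q where q: "\<And>d. d \<in> D \<Longrightarrow> q d \<in> mon_span (X d)" "\<And>d. d \<in> D \<Longrightarrow> f d = \<phi> (q d)"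
        by metis
      have qT: "q d \<in> mon_span T" if "d \<in> D" for d
        using q(1)[OF that] mon_span_mono[OF XT[OF that]] by blast
      have "finsum M f D = finsum M (\<lambda>d. \<phi> (q d)) D"
        by (rule finsum_cong') (auto simp: q(2) intro: closed qT)
      then have "\<phi> p = \<phi> (sum q D)"
        using f p(2) finsum_eq[OF finD qT] by simp
      moreover have "sum q D \<in> mon_span T" using qT by (rule mon_span_sum)
      ultimately have pq: "p = sum q D" using inj[OF p(1)] by blast
      have "q d = r d" if "d \<in> D" for d
      proof (rule poly_mapping_eqI)
        fix m
        show "lookup (q d) m = lookup (r d) m"
        proof (cases "m \<in> X d")
          case True
          then show ?thesis using lookup_sum_X[of q, OF q(1) that True] by (simp add: lr pq)
        next
          case False
          then have "m \<notin> keys (q d)" using q(1)[OF that] by (auto simp: mon_span_def)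
          then show ?thesis using False by (simp add: lr in_keys_iff)
        qed
      qed
      then have "f d = (\<lambda>d\<in>D. \<phi> (r d)) d" if "d \<in> D" for d using that q(2) by simp
      then show "f = (\<lambda>d\<in>D. \<phi> (r d))"
        using conjunct1[OF f] by (intro extensionalityI[of f D]) (simp_all only: PiE_iff restrict_extensional)
    qed
  qed
  have "stanley_decomposition V M gr D"
    unfolding stanley_decomposition_def using finD space decomp by (intro conjI ballI)
  moreover have "enat c \<le> sdepth_decomposition D"
    unfolding sdepth_decomposition_def
  proof (rule INF_greatest)
    fix d assume "d \<in> D"
    then obtain b where b: "b \<in> B" "d = F b" unfolding D_def by blast
    then show "enat c \<le> (case d of (u, Z) \<Rightarrow> enat (card Z))"
      using B[OF b(1)] by (simp add: F_def)
  qed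
  ultimately show ?thesis
    unfolding sdepth_def by (intro SUP_upper2[of D]) simp_all
qed

end

section \<open>Monomial ideals\<close>

lemma polys_in_0: "0 \<in> polys_in V" and polys_in_1: "1 \<in> polys_in V"
  by (simp_all add: polys_in_iff)

lemma polys_in_add: "p \<in> polys_in V \<Longrightarrow> q \<in> polys_in V \<Longrightarrow> p + q \<in> polys_in V"
  unfolding polys_in_eq_mon_span by (rule mon_span_add)

lemma polys_in_uminus: "p \<in> polys_in V \<Longrightarrow> - p \<in> polys_in V"
  unfolding polys_in_iff by (simp add: in_keys_iff)

lemma mon_span_mult:
  assumes "p \<in> mon_span S" "q \<in> mon_span T" "\<And>a b. a \<in> S \<Longrightarrow> b \<in> T \<Longrightarrow> a + b \<in> U"
  shows "p * q \<in> mon_span U"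
proof -
  have "keys (p * q) \<subseteq> {a + b |a b. a \<in> keys p \<and> b \<in> keys q}" by (rule keys_mult)
  then show ?thesis using assms unfolding mon_span_def by blast
qed

lemma polys_in_mult: "p \<in> polys_in V \<Longrightarrow> q \<in> polys_in V \<Longrightarrow> p * q \<in> polys_in V"
  unfolding polys_in_eq_mon_span by (rule mon_span_mult) (auto simp: keys_add_nat)

lemma poly_ring_simps [simp]:
  "carrier (poly_ring V) = polys_in V" "p \<otimes>\<^bsub>poly_ring V\<^esub> q = p * q" "\<one>\<^bsub>poly_ring V\<^esub> = 1"
  "\<zero>\<^bsub>poly_ring V\<^esub> = 0" "p \<oplus>\<^bsub>poly_ring V\<^esub> q = p + q"
  by (simp_all add: poly_ring_def)

lemma poly_ring_cring: "cring (poly_ring V :: ('v, 'k::field) mpoly ring)"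
proof (rule cringI)
  show "abelian_group (poly_ring V :: ('v, 'k) mpoly ring)"
  proof (rule abelian_groupI)
    fix p :: "('v, 'k) mpoly" assume "p \<in> carrier (poly_ring V)"
    then show "\<exists>q\<in>carrier (poly_ring V). q \<oplus>\<^bsub>poly_ring V\<^esub> p = \<zero>\<^bsub>poly_ring V\<^esub>"
      by (intro bexI[of _ "- p"]) (simp_all add: polys_in_uminus)
  qed (simp_all add: polys_in_0 polys_in_add ac_simps)
  show "Group.comm_monoid (poly_ring V :: ('v, 'k) mpoly ring)"
    by (rule comm_monoidI) (simp_all add: polys_in_1 polys_in_mult ac_simps)
qed (simp add: distrib_right)

lemma poly_ring_minus:
  assumes "p \<in> polys_in V" "q \<in> polys_in V"
  shows "p \<ominus>\<^bsub>poly_ring V\<^esub> q = (p - q :: ('v, 'k::field) mpoly)"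
proof -
  interpret cring "poly_ring V :: ('v, 'k) mpoly ring" by (rule poly_ring_cring)
  have "\<ominus>\<^bsub>poly_ring V\<^esub> q = - q"
    by (rule minus_equality) (use assms polys_in_uminus in auto)
  then show ?thesis by (simp add: a_minus_def)
qed

lemma ideal_mon_span:
  assumes T: "T \<subseteq> {m. keys m \<subseteq> V}" and up: "\<And>a b. a \<in> T \<Longrightarrow> keys b \<subseteq> V \<Longrightarrow> b + a \<in> T"
  shows "ideal (mon_span T :: ('v, 'k::field) mpoly set) (poly_ring V)"
proof -
  interpret cring "poly_ring V :: ('v, 'k) mpoly ring" by (rule poly_ring_cring)
  have sub: "mon_span T \<subseteq> (polys_in V :: ('v, 'k) mpoly set)"
    unfolding polys_in_eq_mon_span by (rule mon_span_mono[OF T])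
  have mult: "x * a \<in> mon_span T" if "a \<in> mon_span T" "x \<in> polys_in V" for a x :: "('v, 'k) mpoly"
    using that unfolding polys_in_eq_mon_span by (intro mon_span_mult[of x _ a T]) (use up in auto)
  show ?thesis
  proof (rule idealI)
    show "subgroup (mon_span T :: ('v, 'k) mpoly set) (add_monoid (poly_ring V))"
    proof (rule add.subgroupI)
      show "\<ominus>\<^bsub>poly_ring V\<^esub> a \<in> mon_span T" if a: "a \<in> mon_span T" for a :: "('v, 'k) mpoly"
      proof -
        have "\<ominus>\<^bsub>poly_ring V\<^esub> a = - a"
          by (rule minus_equality) (use a sub polys_in_uminus in auto)
        then show ?thesis using a by (simp add: mon_span_def subset_iff in_keys_iff)
      qed
      show "mon_span T \<noteq> ({} :: ('v, 'k) mpoly set)" using mon_span_0 by blast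
    qed (use sub mon_span_add in auto)
  qed (use mult in \<open>auto simp: ring_axioms mult.commute\<close>)
qed

lemma poly_eq_sum_monomials:
  "p = (\<Sum>m\<in>keys p. Poly_Mapping.single 0 (lookup p m) * Poly_Mapping.single m (1::'k::field))"
proof (rule poly_mapping_eqI)
  fix m
  have "lookup (\<Sum>m\<in>keys p. Poly_Mapping.single 0 (lookup p m) * Poly_Mapping.single m (1::'k)) m =
      (\<Sum>m'\<in>keys p. if m' = m then lookup p m' else 0)"
    by (simp add: mult_single lookup_sum lookup_single when_def)
  also have "\<dots> = lookup p m" by (simp add: sum.delta in_keys_iff)
  finally show "lookup p m = lookup (\<Sum>m\<in>keys p. Poly_Mapping.single 0 (lookup p m) * Poly_Mapping.single m (1::'k)) m" ..
qed

text \<open>Reduces an inclusion to monomials: coefficients act as constant polynomials, so an ideal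
  contains every combination of its monomials.\<close>

lemma mon_span_subset_ideal:
  fixes I :: "('v, 'k::field) mpoly set"
  assumes "ideal I (poly_ring V)" and "\<And>m. m \<in> T \<Longrightarrow> Poly_Mapping.single m 1 \<in> I"
  shows "mon_span T \<subseteq> I"
proof
  interpret ideal I "poly_ring V" by (rule assms(1))
  fix p :: "('v, 'k) mpoly" assume p: "p \<in> mon_span T"
  have "(\<Sum>m\<in>K. Poly_Mapping.single 0 (lookup p m) * Poly_Mapping.single m 1) \<in> I"
    if "finite K" "K \<subseteq> T" for K
    using that
  proof (induction K rule: finite_induct)
    case empty
    then show ?case using additive_subgroup.zero_closed[OF additive_subgroup_axioms] by simp
  next
    case (insert m K)
    have "Poly_Mapping.single 0 (lookup p m) \<in> polys_in V" by (simp add: polys_in_iff)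
    then have "Poly_Mapping.single 0 (lookup p m) * Poly_Mapping.single m 1 \<in> I"
      using I_l_closed[of "Poly_Mapping.single m 1" "Poly_Mapping.single 0 (lookup p m)"]
        assms(2) insert.prems by simp
    moreover have "(\<Sum>m\<in>K. Poly_Mapping.single 0 (lookup p m) * Poly_Mapping.single m 1) \<in> I"
      using insert by simp
    ultimately show ?case
      using additive_subgroup.a_closed[OF additive_subgroup_axioms] insert.hyps by fastforce
  qed
  from this[of "keys p"] show "p \<in> I"
    using p poly_eq_sum_monomials[of p] by (simp add: mon_span_def)
qed

section \<open>Powers of the cover ideal of a bipartite graph\<close>

text \<open>For the edges \<open>R\<close> of a bipartite graph these are the monomials of the
  \<open>k\<close>-th symbolic power of the cover ideal; for \<open>k = 1\<close> their supports are
  the vertex covers.\<close>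

definition edge_monomials :: "'v set \<Rightarrow> ('v \<times> 'v) set \<Rightarrow> nat \<Rightarrow> ('v \<Rightarrow>\<^sub>0 nat) set" where
  "edge_monomials V R k = {m. keys m \<subseteq> V \<and> (\<forall>(i, j)\<in>R. k \<le> lookup m i + lookup m j)}"

lemma edge_monomials_up: "a \<in> edge_monomials V R k \<Longrightarrow> keys b \<subseteq> V \<Longrightarrow> b + a \<in> edge_monomials V R k"
proof -
  assume a: "a \<in> edge_monomials V R k" and b: "keys b \<subseteq> V"
  have "k \<le> lookup (b + a) i + lookup (b + a) j" if "(i, j) \<in> R" for i j
  proof -
    have "k \<le> lookup a i + lookup a j" using a that by (auto simp: edge_monomials_def)
    then show ?thesis by (simp add: lookup_add)
  qed
  then show ?thesis using a b by (auto simp: edge_monomials_def keys_add_nat)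
qed

lemma ideal_edge_monomials: "ideal (mon_span (edge_monomials V R k)) (poly_ring V)"
  by (rule ideal_mon_span[OF _ edge_monomials_up]) (auto simp: edge_monomials_def)

text \<open>A monomial whose exponents at \<open>i\<close> and \<open>j\<close> are not both zero is
  divisible by one of the two variables.\<close>

lemma Idl_pair:
  assumes "i \<in> V" "j \<in> V"
  shows "Idl\<^bsub>poly_ring V\<^esub> (var ` {i, j}) =
    (mon_span (edge_monomials V {(i, j)} 1) :: ('v, 'k::field) mpoly set)"
proof -
  interpret cring "poly_ring V :: ('v, 'k) mpoly ring" by (rule poly_ring_cring)
  let ?I = "Idl\<^bsub>poly_ring V\<^esub> (var ` {i, j}) :: ('v, 'k) mpoly set"
  have vc: "var ` {i, j} \<subseteq> carrier (poly_ring V :: ('v, 'k) mpoly ring)"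
    using assms by (auto simp: var_def polys_in_iff)
  have idl: "ideal ?I (poly_ring V)" by (rule genideal_ideal[OF vc])
  have "Poly_Mapping.single m 1 \<in> ?I" if m: "m \<in> edge_monomials V {(i, j)} 1" for m
  proof -
    obtain x where x: "x \<in> {i, j}" "1 \<le> lookup m x"
    proof (cases "1 \<le> lookup m i")
      case True
      then show ?thesis by (intro that[of i]) auto
    next
      case False
      then show ?thesis using m by (intro that[of j]) (auto simp: edge_monomials_def)
    qed
    let ?s = "Poly_Mapping.single x 1 :: 'v \<Rightarrow>\<^sub>0 nat"
    have "m = (m - ?s) + ?s"
      by (rule poly_mapping_eqI) (use x(2) in \<open>auto simp: lookup_add lookup_minus lookup_single when_def\<close>)
    then have "Poly_Mapping.single m 1 = Poly_Mapping.single (m - ?s) 1 * (var x :: ('v, 'k) mpoly)"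
      by (simp add: var_def mult_single)
    moreover have "var x \<in> ?I" using genideal_self[OF vc] x(1) by blast
    moreover have "(Poly_Mapping.single (m - ?s) 1 :: ('v, 'k) mpoly) \<in> polys_in V"
    proof -
      have "keys (m - ?s) \<subseteq> keys m" by (auto simp: in_keys_iff lookup_minus)
      then show ?thesis using m by (auto simp: polys_in_iff edge_monomials_def)
    qed
    ultimately show ?thesis using ideal.I_l_closed[OF idl, of "var x" "Poly_Mapping.single (m - ?s) 1"] by simp
  qed
  then have "mon_span (edge_monomials V {(i, j)} 1) \<subseteq> ?I" by (rule mon_span_subset_ideal[OF idl])
  moreover have "?I \<subseteq> mon_span (edge_monomials V {(i, j)} 1)"
  proof (rule genideal_minimal[OF ideal_edge_monomials])
    show "var ` {i, j} \<subseteq> mon_span (edge_monomials V {(i, j)} 1)"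
      using assms by (auto simp: var_def mon_span_def edge_monomials_def lookup_single when_def)
  qed
  ultimately show ?thesis by blast
qed

text \<open>Intersecting spans of monomials intersects the sets of exponents. The factor
  \<open>polys_in V\<close> supplies the condition on the support when \<open>R\<close> is
  empty.\<close>

lemma cover_ideal_eq:
  assumes "R \<subseteq> V \<times> V" and E: "E = (\<lambda>(i, j). {i, j}) ` R"
  shows "cover_ideal V E = (mon_span (edge_monomials V R 1) :: ('v, 'k::field) mpoly set)"
proof -
  have "cover_ideal V E = polys_in V \<inter> (\<Inter>(i, j)\<in>R. Idl\<^bsub>poly_ring V\<^esub> (var ` {i, j}) :: ('v, 'k) mpoly set)"
    unfolding cover_ideal_def E by (simp add: case_prod_beta)
  also have "\<dots> = polys_in V \<inter> (\<Inter>(i, j)\<in>R. mon_span (edge_monomials V {(i, j)} 1))"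
  proof (intro arg_cong2[of _ _ _ _ "(\<inter>)"] INF_cong refl)
    fix e assume "e \<in> R"
    then show "((case e of (i, j) \<Rightarrow> Idl\<^bsub>poly_ring V\<^esub> (var ` {i, j})) :: ('v, 'k) mpoly set) =
        (case e of (i, j) \<Rightarrow> mon_span (edge_monomials V {(i, j)} 1))"
      using assms(1) Idl_pair[of "fst e" V "snd e"] by (cases e) (simp only: case_prod_conv fst_conv snd_conv, blast)
  qed
  also have "\<dots> = mon_span (edge_monomials V R 1)"
    unfolding polys_in_def mon_span_def edge_monomials_def by blast
  finally show ?thesis .
qed

text \<open>A monomial of weight at least \<open>k + 1\<close> on every edge splits off the vertex cover consisting of
  the vertices of \<open>A\<close> in its support and the vertices of \<open>B\<close> with exponent greater than \<open>k\<close>.\<close>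
lemma edge_monomials_split:
  assumes "A \<inter> B = {}" "R \<subseteq> A \<times> B" "m \<in> edge_monomials V R (Suc k)"
  obtains c m' where "m = m' + c" "m' \<in> edge_monomials V R k" "c \<in> edge_monomials V R 1"
proof -
  \<comment> \<open>\<open>C\<close> is kept inside the support of \<open>m\<close>, because
    \<open>mapp\<close> in the next definition only changes nonzero entries.\<close>
  define C where "C = {i \<in> keys m. i \<in> A \<or> (i \<in> B \<and> k < lookup m i)}"
  define c where "c = Poly_Mapping.mapp (\<lambda>i _. if i \<in> C then 1 else (0::nat)) m"
  have lc: "lookup c i = (if i \<in> C then 1 else 0)" for i
    by (auto simp: c_def lookup_mapp when_def C_def)
  have le: "lookup c i \<le> lookup m i" for i
    by (auto simp: lc C_def in_keys_iff)
  have m: "Suc k \<le> lookup m i + lookup m j" if "(i, j) \<in> R" for i j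
    using assms(3) that by (auto simp: edge_monomials_def)
  have mV: "keys m \<subseteq> V" using assms(3) by (simp add: edge_monomials_def)
  show ?thesis
  proof (rule that[of "m - c" c])
    show "m = m - c + c" by (rule poly_mapping_eqI) (simp add: lookup_add lookup_minus le)
    \<comment> \<open>If \<open>i\<close> is outside \<open>C\<close>, its exponent is 0 and
      \<open>j\<close> has exponent above \<open>k\<close>. If both ends lie in \<open>C\<close>,
      the exponent at \<open>j\<close> alone still leaves \<open>k\<close>. If only \<open>i\<close>
      lies in \<open>C\<close>, the total weight drops by one.\<close>
    have "k \<le> lookup (m - c) i + lookup (m - c) j \<and> 1 \<le> lookup c i + lookup c j" if "(i, j) \<in> R" for i j
    proof -
      have "i \<in> A" "j \<in> B" "i \<notin> B" "j \<notin> A" using that assms(1,2) by auto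
      then have "i \<in> C \<longleftrightarrow> lookup m i \<noteq> 0" "j \<in> C \<longleftrightarrow> k < lookup m j"
        by (auto simp: C_def in_keys_iff)
      then show ?thesis using m[OF that] by (auto simp: lookup_minus lc)
    qed
    moreover have "keys (m - c) \<subseteq> V" "keys c \<subseteq> V"
      using mV by (auto simp: in_keys_iff lookup_minus lc C_def subset_iff)
    ultimately show "m - c \<in> edge_monomials V R k" "c \<in> edge_monomials V R 1"
      by (auto simp: edge_monomials_def)
  qed
qed

text \<open>Ordinary and symbolic powers agree for bipartite graphs. Weights add under
  multiplication, which gives one inclusion; splitting off a vertex cover by
  \<open>edge_monomials_split\<close> gives the other.\<close>

lemma cover_ideal_power:
  assumes "A \<inter> B = {}" "R \<subseteq> A \<times> B"
  shows "(mon_span (edge_monomials V R 1)) [^]\<^bsub>ideals_set (poly_ring V)\<^esub> k =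
    (mon_span (edge_monomials V R k) :: ('v, 'k::field) mpoly set)"
proof (induction k)
  case 0
  have "edge_monomials V R 0 = {m. keys m \<subseteq> V}" by (auto simp: edge_monomials_def)
  then show ?case by (simp add: ideals_set_def polys_in_eq_mon_span nat_pow_def)
next
  case (Suc k)
  interpret cring "poly_ring V :: ('v, 'k) mpoly ring" by (rule poly_ring_cring)
  let ?J = "\<lambda>k. mon_span (edge_monomials V R k) :: ('v, 'k) mpoly set"
  have idl: "ideal (?J k) (poly_ring V)" for k by (rule ideal_edge_monomials)
  have "?J 1 [^]\<^bsub>ideals_set (poly_ring V)\<^esub> Suc k = ideal_prod (poly_ring V) (?J k) (?J 1)"
    using Suc by (simp add: ideals_set_def nat_pow_def)
  also have "\<dots> = ?J (Suc k)"
  proof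
    show "ideal_prod (poly_ring V) (?J k) (?J 1) \<subseteq> ?J (Suc k)"
    proof
      fix x :: "('v, 'k) mpoly" assume "x \<in> ideal_prod (poly_ring V) (?J k) (?J 1)"
      then show "x \<in> ?J (Suc k)"
      proof (induction rule: ideal_prod.induct)
        case (prod i j)
        have "i * j \<in> ?J (Suc k)"
          by (rule mon_span_mult[OF prod])
            (fastforce simp: edge_monomials_def keys_add_nat lookup_add)
        then show ?case by simp
      next
        case (sum s1 s2)
        then show ?case by (simp add: mon_span_add)
      qed
    qed
    show "?J (Suc k) \<subseteq> ideal_prod (poly_ring V) (?J k) (?J 1)"
    proof (rule mon_span_subset_ideal[OF ideal_prod_is_ideal[OF idl idl]])
      fix m assume "m \<in> edge_monomials V R (Suc k)"
      then obtain c m' where m: "m = m' + c" "m' \<in> edge_monomials V R k" "c \<in> edge_monomials V R 1"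
        by (rule edge_monomials_split[OF assms])
      have "Poly_Mapping.single m' 1 \<otimes>\<^bsub>poly_ring V\<^esub> Poly_Mapping.single c 1
          \<in> ideal_prod (poly_ring V) (?J k) (?J 1)"
        by (rule ideal_prod.prod) (use m in \<open>simp_all add: mon_span_def\<close>)
      then show "Poly_Mapping.single m 1 \<in> ideal_prod (poly_ring V) (?J k) (?J 1)"
        by (simp add: mult_single m(1))
    qed
  qed
  finally show ?case .
qed

section \<open>Stanley depth of monomial ideals and their quotients\<close>

lemma monomial_in_component:
  "keys u \<subseteq> V \<Longrightarrow> Poly_Mapping.single u 1 \<in> poly_component V (\<lambda>v. int (lookup u v))"
  by (simp add: poly_component_def polys_in_iff)

lemma monomial_basis_ideal:
  assumes "T \<subseteq> {m. keys m \<subseteq> V}"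
  shows "monomial_basis V T (ideal_module (mon_span T))
    (ideal_component V (mon_span T :: ('v, 'k::field) mpoly set)) (\<lambda>p. p)"
proof (rule monomial_basis.intro)
  show "abelian_monoid (ideal_module (mon_span T :: ('v, 'k) mpoly set))"
    by (rule abelian_monoidI) (simp_all add: ideal_module_def mon_span_0 mon_span_add ac_simps)
  show "Poly_Mapping.single u 1 \<in> ideal_component V (mon_span T :: ('v, 'k) mpoly set) (\<lambda>v. int (lookup u v))"
    if "u \<in> T" for u
    using assms that by (auto simp: ideal_component_def mon_span_def intro!: monomial_in_component)
qed (simp_all add: ideal_module_def bij_betw_def)

text \<open>The residue classes of the monomials outside \<open>T\<close> form a basis. A difference
  of two polynomials supported outside \<open>T\<close> that lies in \<open>I\<close> has no
  monomials left.\<close>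

lemma monomial_basis_quotient:
  fixes V :: "'v set" and I :: "('v, 'k::field) mpoly set"
  assumes T: "T \<subseteq> {m. keys m \<subseteq> V}" and up: "\<And>a b. a \<in> T \<Longrightarrow> keys b \<subseteq> V \<Longrightarrow> b + a \<in> T"
    and I: "I = mon_span T"
  shows "monomial_basis V ({m. keys m \<subseteq> V} - T) (quotient_module V I) (quotient_component V I)
    (\<lambda>p. I +>\<^bsub>poly_ring V\<^esub> p)"
proof -
  interpret cring "poly_ring V :: ('v, 'k) mpoly ring" by (rule poly_ring_cring)
  interpret ideal I "poly_ring V" unfolding I by (rule ideal_mon_span[OF T up])
  interpret Q: ring "poly_ring V Quot I" by (rule quotient_is_ring)
  let ?N = "mon_span ({m. keys m \<subseteq> V} - T) :: ('v, 'k) mpoly set"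
  let ?\<phi> = "\<lambda>p. I +>\<^bsub>poly_ring V\<^esub> p"
  have NV: "p \<in> polys_in V" if "p \<in> ?N" for p
    using that unfolding polys_in_eq_mon_span mon_span_def by blast
  have sm: "carrier (quotient_module V I) = a_rcosets\<^bsub>poly_ring V\<^esub> I"
    "\<zero>\<^bsub>quotient_module V I\<^esub> = I" "X \<oplus>\<^bsub>quotient_module V I\<^esub> Y = X <+>\<^bsub>poly_ring V\<^esub> Y"
    "p \<odot>\<^bsub>quotient_module V I\<^esub> X = rcoset_mult (poly_ring V) I (?\<phi> p) X" for X Y p
    by (simp_all add: quotient_module_def FactRing_def Let_def)
  have eq_iff: "?\<phi> p = ?\<phi> q \<longleftrightarrow> p - q \<in> I" if "p \<in> polys_in V" "q \<in> polys_in V" for p q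
    using quotient_eq_iff_same_a_r_cos[OF is_ideal, of p q] that poly_ring_minus[OF that] by simp
  have Q_eq: "carrier (quotient_module V I) = carrier (poly_ring V Quot I)"
    "\<zero>\<^bsub>quotient_module V I\<^esub> = \<zero>\<^bsub>poly_ring V Quot I\<^esub>"
    "X \<oplus>\<^bsub>quotient_module V I\<^esub> Y = X \<oplus>\<^bsub>poly_ring V Quot I\<^esub> Y" for X Y
    by (simp_all add: quotient_module_def Let_def)
  show ?thesis
  proof (rule monomial_basis.intro)
    show "abelian_monoid (quotient_module V I)"
      by (rule abelian_monoidI)
        (unfold Q_eq, (rule Q.a_closed Q.zero_closed Q.a_assoc Q.l_zero Q.a_comm; assumption)+)
    show "bij_betw ?\<phi> ?N (carrier (quotient_module V I))"
      unfolding bij_betw_def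
    proof
      show "inj_on ?\<phi> ?N"
      proof (rule inj_onI)
        fix p q assume p: "p \<in> ?N" and q: "q \<in> ?N" and "?\<phi> p = ?\<phi> q"
        then have "p - q \<in> I" using eq_iff[OF NV[OF p] NV[OF q]] by simp
        then have "keys (p - q) \<subseteq> T" by (simp add: I mon_span_def)
        moreover have "keys (p - q) \<subseteq> keys p \<union> keys q" by (auto simp: in_keys_iff lookup_minus)
        ultimately have "keys (p - q) = {}" using p q unfolding mon_span_def by blast
        then have "lookup (p - q) m = 0" for m using in_keys_iff[of m "p - q"] by simp
        then show "p = q" by (intro poly_mapping_eqI) (simp add: lookup_minus)
      qed
      show "?\<phi> ` ?N = carrier (quotient_module V I)"
      proof (intro equalityI subsetI)
        fix X assume "X \<in> ?\<phi> ` ?N"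
        then show "X \<in> carrier (quotient_module V I)"
          using NV a_rcosetsI[OF a_subset] unfolding sm by auto
      next
        fix X assume "X \<in> carrier (quotient_module V I)"
        then obtain p where p: "p \<in> polys_in V" "X = ?\<phi> p" unfolding sm A_RCOSETS_defs a_r_coset_def by auto
        \<comment> \<open>Deleting the terms with exponents in \<open>T\<close> gives the
          representative of the coset supported outside \<open>T\<close>.\<close>
        define q where "q = Poly_Mapping.mapp (\<lambda>m c. if m \<in> T then 0 else c) p"
        have lq: "lookup q m = (if m \<in> T then 0 else lookup p m)" for m
          by (auto simp: q_def lookup_mapp when_def in_keys_iff)
        have qN: "q \<in> ?N"
        proof -
          have "keys q \<subseteq> keys p - T" by (auto simp: in_keys_iff lq split: if_splits)
          then show ?thesis using p(1) unfolding polys_in_def mon_span_def by blast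
        qed
        have "p - q \<in> I" by (auto simp: I mon_span_def in_keys_iff lookup_minus lq split: if_splits)
        then have "X = ?\<phi> q" using eq_iff[OF p(1) NV[OF qN]] p(2) by simp
        then show "X \<in> ?\<phi> ` ?N" using qN by blast
      qed
    qed
    show "?\<phi> 0 = \<zero>\<^bsub>quotient_module V I\<^esub>"
      unfolding sm using a_rcos_zero[OF is_ideal additive_subgroup.zero_closed[OF additive_subgroup_axioms]] by simp
    show "?\<phi> (p + q) = ?\<phi> p \<oplus>\<^bsub>quotient_module V I\<^esub> ?\<phi> q" if "p \<in> ?N" "q \<in> ?N" for p q
      unfolding sm using a_rcos_sum[of p q] NV that by simp
    show "v \<odot>\<^bsub>quotient_module V I\<^esub> ?\<phi> (Poly_Mapping.single u 1) = ?\<phi> (v * Poly_Mapping.single u 1)"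
      if "v \<in> polys_in V" "u \<in> {m. keys m \<subseteq> V} - T" for u v
      unfolding sm using rcoset_mult_add[of v "Poly_Mapping.single u 1"] that by (simp add: polys_in_iff)
    show "?\<phi> (Poly_Mapping.single u 1) \<in> quotient_component V I (\<lambda>v. int (lookup u v))"
      if "u \<in> {m. keys m \<subseteq> V} - T" for u
      unfolding quotient_component_def using that by (intro imageI monomial_in_component) simp
  qed
qed

section \<open>The bounds\<close>

text \<open>Returns from exponent functions to monomials. Every corner belongs to \<open>X\<close>
  and therefore vanishes off the finite set \<open>V\<close>, so \<open>Abs_poly_mapping\<close>
  keeps its values.\<close>

lemma box_decomp_mon_box:
  assumes "finite V" "box_decomp V d X" "X \<subseteq> {a. \<forall>v. v \<notin> V \<longrightarrow> a v = 0}"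
  obtains B where "finite B"
    "\<And>b. b \<in> B \<Longrightarrow> snd b \<subseteq> V \<and> card V - d \<le> card (snd b) \<and> mon_box b \<subseteq> {m. lookup m \<in> X}"
    "\<And>m. lookup m \<in> X \<Longrightarrow> \<exists>!b. b \<in> B \<and> m \<in> mon_box b"
proof -
  obtain B where "finite B \<and>
    (\<forall>(u, Z)\<in>B. Z \<subseteq> V \<and> card (V - Z) \<le> d \<and> box u Z \<subseteq> X) \<and>
    (\<forall>a\<in>X. \<exists>!b. b \<in> B \<and> a \<in> case_prod box b)"
    using box_decomp_partition[OF assms(2)] ..
  note B = this[THEN conjunct1] this[THEN conjunct2, THEN conjunct1]
    this[THEN conjunct2, THEN conjunct2]
  define F where "F = (\<lambda>(u, Z). (Abs_poly_mapping u :: 'a \<Rightarrow>\<^sub>0 nat, Z :: 'a set))"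
  have b: "snd b \<subseteq> V" "card (V - snd b) \<le> d" "box (fst b) (snd b) \<subseteq> X" if "b \<in> B" for b
    using bspec[OF B(2) that] by (simp_all add: case_prod_beta)
  have look: "lookup (Abs_poly_mapping (fst b)) = fst b" if "b \<in> B" for b
  proof (rule lookup_Abs_poly_mapping)
    have "fst b \<in> box (fst b) (snd b)" by (simp add: box_def)
    then have "fst b \<in> X" using b(3)[OF that] by (rule rev_subsetD)
    from subsetD[OF assms(3) this] have "{x. fst b x \<noteq> 0} \<subseteq> V" by auto
    then show "finite {x. fst b x \<noteq> 0}" using assms(1) by (rule finite_subset)
  qed
  have mb: "m \<in> mon_box (F b) \<longleftrightarrow> lookup m \<in> box (fst b) (snd b)" if "b \<in> B" for b m
    using look[OF that] by (simp add: mon_box_def F_def case_prod_beta)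
  show ?thesis
  proof (rule that[of "F ` B"])
    show "finite (F ` B)" using B(1) by simp
    show "snd c \<subseteq> V \<and> card V - d \<le> card (snd c) \<and> mon_box c \<subseteq> {m. lookup m \<in> X}" if "c \<in> F ` B" for c
    proof -
      from that obtain b' where b': "b' \<in> B" "c = F b'" by blast
      have "snd c = snd b'" by (simp add: b'(2) F_def case_prod_beta)
      moreover have "card V - d \<le> card (snd b')"
        using b(2)[OF b'(1)] card_Diff_subset[OF finite_subset[OF b(1)[OF b'(1)] assms(1)] b(1)[OF b'(1)]]
        by linarith
      moreover have "mon_box c \<subseteq> {m. lookup m \<in> X}"
        using mb[OF b'(1)] b(3)[OF b'(1)] unfolding b'(2) by blast
      ultimately show ?thesis using b(1)[OF b'(1)] by simp
    qed
    show "\<exists>!c. c \<in> F ` B \<and> m \<in> mon_box c" if m: "lookup m \<in> X" for m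
    proof -
      obtain b' where b': "b' \<in> B" "lookup m \<in> case_prod box b'"
        and u: "\<And>b''. b'' \<in> B \<and> lookup m \<in> case_prod box b'' \<Longrightarrow> b'' = b'"
        using bspec[OF B(3) m] by (rule ex1E) blast
      show ?thesis
      proof (rule ex1I[of _ "F b'"])
        show "F b' \<in> F ` B \<and> m \<in> mon_box (F b')"
          using b' mb[OF b'(1), of m] by (simp add: case_prod_beta)
        fix c assume c: "c \<in> F ` B \<and> m \<in> mon_box c"
        then obtain b'' where b'': "b'' \<in> B" "c = F b''" by blast
        then have "lookup m \<in> case_prod box b''" using c mb[OF b''(1), of m] by (simp add: case_prod_beta)
        then show "c = F b'" using u[of b''] b'' by blast
      qed
    qed
  qed
qed

lemma (in monomial_basis) sdepth_ge_box_decomp: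
  assumes "finite V" "box_decomp V d X" "X \<subseteq> {a. \<forall>v. v \<notin> V \<longrightarrow> a v = 0}"
    and T: "{m. lookup m \<in> X} = T"
  shows "enat (card V - d) \<le> sdepth V M gr"
proof (rule box_decomp_mon_box[OF assms(1-3)])
  fix B
  assume B: "finite B"
    "\<And>b. b \<in> B \<Longrightarrow> snd b \<subseteq> V \<and> card V - d \<le> card (snd b) \<and> mon_box b \<subseteq> {m. lookup m \<in> X}"
    "\<And>m. lookup m \<in> X \<Longrightarrow> \<exists>!b. b \<in> B \<and> m \<in> mon_box b"
  show ?thesis
  proof (rule sdepth_ge[OF B(1)])
    show "snd b \<subseteq> V \<and> card V - d \<le> card (snd b) \<and> mon_box b \<subseteq> T" if "b \<in> B" for b
      using B(2)[OF that] unfolding T .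
    show "\<exists>!b. b \<in> B \<and> m \<in> mon_box b" if "m \<in> T" for m
    proof (rule B(3))
      show "lookup m \<in> X" using that unfolding T[symmetric] by (rule CollectD)
    qed
  qed
qed

theorem theorem3p3:
  fixes V :: "'v set" and E :: "'v set set" and n k :: nat
    and J :: "('v, 'k::field) mpoly set"
  assumes "simple_graph V E" and "bipartite V E" and "card V = n"
    and "J = cover_ideal V E" and "k \<ge> 1"
  shows "sdepth_ideal V (J [^]\<^bsub>ideals_set (poly_ring V)\<^esub> k)
           \<ge> enat (n - ordered_matching_number E)
       \<and> sdepth_quotient V (J [^]\<^bsub>ideals_set (poly_ring V)\<^esub> k)
           \<ge> enat (n - ordered_matching_number E - 1)"
proof -
  have finV: "finite V" and edges: "\<forall>e\<in>E. e \<subseteq> V \<and> card e = 2"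
    using assms(1) by (simp_all add: simple_graph_def)
  have finE: "finite E"
  proof (rule finite_subset)
    have "e \<in> Pow V" if "e \<in> E" for e using bspec[OF edges that] by simp
    then show "E \<subseteq> Pow V" by (rule subsetI)
  qed (simp add: finV)
  from assms(2)[unfolded bipartite_def] obtain A where "\<exists>B. A \<union> B = V \<and> A \<inter> B = {} \<and>
      (\<forall>u v. {u, v} \<in> E \<longrightarrow> (u \<in> A \<and> v \<in> B) \<or> (u \<in> B \<and> v \<in> A))" ..
  then obtain B where "A \<union> B = V \<and> A \<inter> B = {} \<and>
      (\<forall>u v. {u, v} \<in> E \<longrightarrow> (u \<in> A \<and> v \<in> B) \<or> (u \<in> B \<and> v \<in> A))" ..
  note AB = this[THEN conjunct1] this[THEN conjunct2, THEN conjunct1]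
    and bip = this[THEN conjunct2, THEN conjunct2, rule_format]
  \<comment> \<open>Each edge is oriented from \<open>A\<close> to \<open>B\<close>, the form in
    which the recursion and the description of the powers need it.\<close>
  define R where "R = {(i, j). i \<in> A \<and> j \<in> B \<and> {i, j} \<in> E}"
  have RAB: "R \<subseteq> A \<times> B" by (auto simp: R_def)
  have E_eq: "E = (\<lambda>(i, j). {i, j}) ` R"
  proof (intro equalityI subsetI)
    fix e assume e: "e \<in> E"
    then obtain u v where uv: "e = {u, v}" using bspec[OF edges e] unfolding card_2_iff by blast
    then have "{u, v} \<in> E" "{v, u} \<in> E" using e by (simp_all add: insert_commute)
    then consider "(u, v) \<in> R" | "(v, u) \<in> R"
      using bip[of u v] unfolding R_def by blast
    then show "e \<in> (\<lambda>(i, j). {i, j}) ` R"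
    proof cases
      case 1
      show ?thesis by (rule image_eqI[OF _ 1]) (simp add: uv)
    next
      case 2
      show ?thesis by (rule image_eqI[OF _ 2]) (simp add: uv insert_commute)
    qed
  next
    fix e assume "e \<in> (\<lambda>(i, j). {i, j}) ` R"
    then show "e \<in> E" unfolding R_def by (elim imageE) (auto split: prod.splits)
  qed
  have indep: "independent_set E A"
    unfolding independent_set_def
  proof (intro ballI notI)
    fix u v assume uv: "u \<in> A" "v \<in> A" "{u, v} \<in> E"
    show False using bip[OF uv(3)] uv(1,2) AB(2) by blast
  qed
  let ?d = "ordered_matching_number E"
  have tri: "length ps \<le> ?d" if "triangular R ps" for ps
    using that R_def AB(2) indep finE by (rule length_triangular_le)
  let ?X = "box (\<lambda>_. 0) V \<inter> {a. \<forall>(i, j)\<in>R. k \<le> a i + a j}"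
  let ?Y = "box (\<lambda>_. 0) V \<inter> {a. \<exists>(i, j)\<in>R. a i + a j < k}"
  \<comment> \<open>The recursion starts with nothing frozen and all lower bounds zero, so
    \<open>card D\<close> contributes 0.\<close>
  have dec: "box_decomp V ?d ?X" "box_decomp V (?d + 1) ?Y"
    using box_decomp_edges[OF finV AB RAB empty_subsetI _ _ tri, of "\<lambda>_. 0" k] by simp_all
  have keys_iff: "lookup m \<in> box (\<lambda>_. 0) V \<longleftrightarrow> keys m \<subseteq> V" for m :: "'v \<Rightarrow>\<^sub>0 nat"
    by (auto simp: box_def in_keys_iff subset_iff)
  let ?T = "edge_monomials V R k"
  have TX: "{m. lookup m \<in> ?X} = ?T"
    by (simp add: edge_monomials_def keys_iff)
  \<comment> \<open>The bad points are the exponents of the monomials outside the power, that is,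
    the basis of the quotient.\<close>
  have TY: "{m. lookup m \<in> ?Y} = {m. keys m \<subseteq> V} - ?T"
  proof -
    have neg: "(\<exists>(i, j)\<in>R. lookup m i + lookup m j < k) \<longleftrightarrow> \<not> (\<forall>(i, j)\<in>R. k \<le> lookup m i + lookup m j)"
      for m :: "'v \<Rightarrow>\<^sub>0 nat" by (simp add: case_prod_beta not_le)
    show ?thesis by (simp only: edge_monomials_def Int_iff keys_iff mem_Collect_eq neg) blast
  qed
  have Jk: "J [^]\<^bsub>ideals_set (poly_ring V)\<^esub> k = mon_span ?T"
  proof -
    have "R \<subseteq> V \<times> V" using RAB AB(1) by blast
    then have "J = mon_span (edge_monomials V R 1)"
      unfolding assms(4) using E_eq by (rule cover_ideal_eq)
    then show ?thesis by (simp only: cover_ideal_power[OF AB(2) RAB])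
  qed
  have TV: "?T \<subseteq> {m. keys m \<subseteq> V}" by (auto simp: edge_monomials_def)
  have supp: "?X \<subseteq> {a. \<forall>v. v \<notin> V \<longrightarrow> a v = 0}" "?Y \<subseteq> {a. \<forall>v. v \<notin> V \<longrightarrow> a v = 0}"
    by (auto simp: box_def)
  have "enat (card V - ?d) \<le> sdepth_ideal V (mon_span ?T :: ('v, 'k) mpoly set)"
    unfolding sdepth_ideal_def
    by (rule monomial_basis.sdepth_ge_box_decomp[OF monomial_basis_ideal[OF TV] finV dec(1) supp(1) TX])
  moreover have "enat (card V - (?d + 1)) \<le> sdepth_quotient V (mon_span ?T :: ('v, 'k) mpoly set)"
    unfolding sdepth_quotient_def
    by (rule monomial_basis.sdepth_ge_box_decomp[OF monomial_basis_quotient[OF TV edge_monomials_up refl]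
        finV dec(2) supp(2) TY])
  ultimately show ?thesis
    using assms(3) unfolding Jk by simp
qed

end
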